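(* Let $M$ be a smooth manifold of dimension $n$, $1\le p,q\le n$, let $(x^1,\dots,x^n)$ be a coordinate system on an open subset of $M$, and let $\omega_p=\sum_{I\in\mathcal{I}_p^n}F_I\,dx^I$ and $V_q=\sum_{I\in\mathcal{I}_q^n}\bar F_I\,\partial x^I$ be a $p$-form and a $q$-vector field on it. Let $\Phi_{j,J},\bar\Phi_{j,J}$ be the expressions, linear in quantities $\Gamma_{cd}^a$, defined in the context. Let $\Psi_{j,J}$ ($J\in\mathcal{I}_p^n$) and $\bar\Psi_{j,J}$ ($J\in\mathcal{I}_q^n$) be obtained from $\Phi_{j,J}$ and $\bar\Phi_{j,J}$ by substituting $\Gamma_{cd}^a=-\sum_b\frac{\partial v_b^a}{\partial x^d}(V^{-1})_c^b$, where $V=(v_j^i)$ is a $GL(n,\mathbb{R})$-valued function. Then the second-order system (i): $\frac{\partial F_J}{\partial x^j}=\Phi_{j,J}$, $J\in\mathcal{I}_p^n$, $1\le j\le n$, on $O_M^2$, with unknowns $(u^1,\dots,u^n)$ and $\Gamma_{cd}^a=\sum_bv_b^a\frac{\partial^2u^b}{\partial x^c\partial x^d}$ ($V=(v^i_j)$ the inverse of the Jacobian matrix $(\partial u^i/\partial x^j)$), is equivalent to the first-order system on $J^1(M,GL(n,\mathbb{R}))$ with unknowns $v_j^i$: $$\frac{\partial F_J}{\partial x^j}=\Psi_{j,J},\quad J\in\mathcal{I}_p^n,\ 1\le j\le n;\qquad \sum_jv_m^j\frac{\partial v_l^k}{\partial x^j}=\sum_i\frac{\partial v_m^k}{\partial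 x^i}v_l^i,\quad 1\le k\le n,\ 1\le l<m\le n.$$ Likewise the second-order system (ii): $\frac{\partial\bar F_J}{\partial x^j}=-\bar\Phi_{j,J}$, $J\in\mathcal{I}_q^n$, $1\le j\le n$, on $O_M^2$, is equivalent to the first-order system $$\frac{\partial\bar F_J}{\partial x^j}=-\bar\Psi_{j,J},\quad J\in\mathcal{I}_q^n,\ 1\le j\le n;\qquad \sum_jv_m^j\frac{\partial v_l^k}{\partial x^j}=\sum_i\frac{\partial v_m^k}{\partial x^i}v_l^i,\quad 1\le k\le n,\ 1\le l<m\le n.$$ Here "equivalent" means: if $(u^1,\dots,u^n)$ is a local solution of the second-order system with $2$-jets in $O_M^2$, then the inverse $V$ of its Jacobian matrix solves the first-order system; and conversely every local solution $V$ of the first-order system is, in a neighbourhood of each point of its domain, the inverse of the Jacobian matrix of a solution $(u^1,\dots,u^n)$ of the second-order system.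
   Context: $\mathcal{I}_p^n$ is the set of multi-indices $I=(i_1,\dots,i_p)$ with $1\le i_1<\dots<i_p\le n$; $dx^I=dx^{i_1}\wedge\cdots\wedge dx^{i_p}$, and $\partial x^I=\frac{\partial}{\partial x^{i_1}}\wedge\cdots\wedge\frac{\partial}{\partial x^{i_q}}$ for $I\in\mathcal I_q^n$. $O_M^2\subset J^2(M,\mathbb{R}^n)$ is the open subbundle of $2$-jets $j^2_x(u^1,\dots,u^n)$ with $(du^1\wedge\cdots\wedge du^n)_x\neq0$. Given quantities $\Gamma_{cd}^a$, the expressions $\Phi_{j,J}$, $\bar\Phi_{j,J}$ ($1\le j\le n$) are defined by $$\sum_{J\in\mathcal{I}_p^n}\Phi_{j,J}\,dx^J=\sum_{I\in\mathcal{I}_p^n}\sum_{h=1}^p\sum_{i=1}^n\Gamma_{ji}^{i_h}F_I\,dx^{i_1}\wedge\cdots\wedge\underline{dx^i}\wedge\cdots\wedge dx^{i_p},$$ $$\sum_{J\in\mathcal{I}_q^n}\bar\Phi_{j,J}\,\partial x^J=\sum_{I\in\mathcal{I}_q^n}\sum_{h=1}^q\sum_{i=1}^n\Gamma_{j i_h}^{i}\bar F_I\,\tfrac{\partial}{\partial x^{i_1}}\wedge\cdots\wedge\underline{\tfrac{\partial}{\partial x^i}}\wedge\cdots\wedge \tfrac{\partial}{\partial x^{i_q}},$$ where the underlined factor replaces the $h$-th factor of the exterior product. Matrices: $\sum_b v_b^a\frac{\partial u^b}{\partial x^c}=\delta_c^a$ when $V=(v^i_j)$ is the inverse of the Jacobian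 matrix, upper index = row, lower index = column. *)

theory Defs
  imports "HOL-Analysis.Analysis"
begin

section \<open>Smooth functions on open subsets of Euclidean space\<close>

text \<open>
  Indices \<open>1, \<dots>, n\<close> are the elements of a finite linearly ordered type \<open>'n\<close>, with
  \<open>n = CARD('n)\<close>.
\<close>

definition partial_deriv :: "'n::finite \<Rightarrow> (real^'n \<Rightarrow> real) \<Rightarrow> real^'n \<Rightarrow> real" where
  "partial_deriv j f y = frechet_derivative f (at y) (axis j 1)"

text \<open>\<open>Ck_on k S f\<close> is meant for open \<open>S\<close>.\<close>

primrec Ck_on :: "nat \<Rightarrow> (real^'n) set \<Rightarrow> (real^'n::finite \<Rightarrow> real) \<Rightarrow> bool" where
  "Ck_on 0 S f \<longleftrightarrow> continuous_on S f"
| "Ck_on (Suc k) S f \<longleftrightarrow> f differentiable_on S \<and> (\<forall>j. Ck_on k S (partial_deriv j f))"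

definition smooth_on :: "(real^'n) set \<Rightarrow> (real^'n::finite \<Rightarrow> real) \<Rightarrow> bool" where
  "smooth_on S f \<longleftrightarrow> (\<forall>k. Ck_on k S f)"


section \<open>Smooth manifolds\<close>

type_synonym 'n rvec = "real^'n"
type_synonym 'n sqmat = "real^'n^'n"

text \<open>A chart is a pair of its domain and its coordinate map; the map is arbitrary off the domain.\<close>

type_synonym ('m, 'n) chart = "'m set \<times> ('m \<Rightarrow> real^'n)"

definition is_chart :: "('m::topological_space, 'n::finite) chart \<Rightarrow> bool" where
  "is_chart c \<longleftrightarrow> (case c of (U, x) \<Rightarrow>
     open U \<and> open (x ` U) \<and> (\<exists>y. homeomorphism U (x ` U) x y))"

definition smooth_transition :: "('m, 'n::finite) chart \<Rightarrow> ('m, 'n) chart \<Rightarrow> bool" where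
  "smooth_transition c d \<longleftrightarrow> (case (c, d) of ((U, x), (U', x')) \<Rightarrow>
     \<forall>i. smooth_on (x ` (U \<inter> U')) (\<lambda>y. x' (inv_into U x y) $ i))"

definition compatible :: "('m, 'n::finite) chart \<Rightarrow> ('m, 'n) chart \<Rightarrow> bool" where
  "compatible c d \<longleftrightarrow> smooth_transition c d \<and> smooth_transition d c"

text \<open>
  The manifold \<open>M\<close> is the whole type \<open>'m\<close>, whose classes supply a Hausdorff and second countable
  topology; the smooth structure is given by an atlas.
\<close>

definition smooth_atlas ::
    "('m::{t2_space, second_countable_topology}, 'n::finite) chart set \<Rightarrow> bool" where
  "smooth_atlas A \<longleftrightarrow> (\<forall>c\<in>A. is_chart c) \<and> (\<Union>c\<in>A. fst c) = UNIV \<and>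
     (\<forall>c\<in>A. \<forall>d\<in>A. compatible c d)"

definition coordinate_system ::
    "('m::{t2_space, second_countable_topology}, 'n::finite) chart set \<Rightarrow> ('m, 'n) chart \<Rightarrow> bool" where
  "coordinate_system A c \<longleftrightarrow> is_chart c \<and> (\<forall>d\<in>A. compatible c d)"

definition smooth_fun_on ::
    "('m::{t2_space, second_countable_topology}, 'n::finite) chart set \<Rightarrow> 'm set \<Rightarrow> ('m \<Rightarrow> real) \<Rightarrow> bool" where
  "smooth_fun_on A W f \<longleftrightarrow>
     (\<forall>(U, x)\<in>A. smooth_on (x ` (U \<inter> W)) (\<lambda>y. f (inv_into U x y)))"

text \<open>
  The differential of \<open>f\<close> at \<open>m\<close>, with the tangent space at \<open>m\<close> identified with \<open>real^'n\<close> by means of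
  the basis of coordinate vector fields of the chart.
\<close>

definition differential ::
    "('m, 'n::finite) chart \<Rightarrow> ('m \<Rightarrow> real) \<Rightarrow> 'm \<Rightarrow> real^'n \<Rightarrow> real" where
  "differential c f m = (case c of (U, x) \<Rightarrow>
     frechet_derivative (\<lambda>y. f (inv_into U x y)) (at (x m)))"

definition coord_deriv ::
    "('m, 'n::finite) chart \<Rightarrow> 'n \<Rightarrow> ('m \<Rightarrow> real) \<Rightarrow> 'm \<Rightarrow> real" where
  "coord_deriv c j f m = differential c f m (axis j 1)"


section \<open>Exterior products\<close>

definition multi_indices :: "nat \<Rightarrow> 'n::linorder list set" where
  "multi_indices p = {I. length I = p \<and> sorted_wrt (<) I}"

text \<open>
  The exterior product \<open>a\<^sub>1 \<and> \<dots> \<and> a\<^sub>p\<close> of functionals on a vector space, as an alternating form.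
  Its arguments are passed as a sequence, of which only the first \<open>p\<close> entries matter.
\<close>

definition wedge :: "('v \<Rightarrow> real) list \<Rightarrow> (nat \<Rightarrow> 'v) \<Rightarrow> real" where
  "wedge as w = (\<Sum>\<sigma> | \<sigma> permutes {..<length as}.
     of_int (sign \<sigma>) * (\<Prod>h<length as. (as ! h) (w (\<sigma> h))))"

text \<open>Coordinate covectors, and coordinate vectors regarded as functionals on the dual space.\<close>

definition dx :: "'n::finite \<Rightarrow> real^'n \<Rightarrow> real" where
  "dx i w = w $ i"

definition ddx :: "'n::finite \<Rightarrow> ((real^'n) \<Rightarrow>\<^sub>L real) \<Rightarrow> real" where
  "ddx i \<alpha> = blinfun_apply \<alpha> (axis i 1)"

text \<open>
  The coefficients of a \<open>p\<close>-form (or \<open>p\<close>-vector) \<open>T\<close> in the basis of exterior products of the \<open>e i\<close>.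
  The lemma \<open>ext_coeffs_eqI\<close> and the lemmas \<open>Phi_expansion\<close> and \<open>Phi_bar_expansion\<close> below show that the
  descriptions used here are well defined.
\<close>

definition is_ext_coeffs ::
    "('n::{finite, linorder} \<Rightarrow> 'v \<Rightarrow> real) \<Rightarrow> nat \<Rightarrow> ((nat \<Rightarrow> 'v) \<Rightarrow> real) \<Rightarrow> ('n list \<Rightarrow> real) \<Rightarrow> bool" where
  "is_ext_coeffs e p T \<phi> \<longleftrightarrow>
     (\<forall>w. (\<Sum>J\<in>multi_indices p. \<phi> J * wedge (map e J) w) = T w) \<and>
     (\<forall>J. J \<notin> multi_indices p \<longrightarrow> \<phi> J = 0)"

definition ext_coeffs ::
    "('n::{finite, linorder} \<Rightarrow> 'v \<Rightarrow> real) \<Rightarrow> nat \<Rightarrow> ((nat \<Rightarrow> 'v) \<Rightarrow> real) \<Rightarrow> 'n list \<Rightarrow> real" where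
  "ext_coeffs e p T = (THE \<phi>. is_ext_coeffs e p T \<phi>)"

text \<open>
  Here \<open>\<Gamma> a c d\<close> stands for the quantity with upper index \<open>a\<close> and lower indices \<open>c\<close>, \<open>d\<close>, and
  \<open>F\<close> for the values of the components of the \<open>p\<close>-form (\<open>q\<close>-vector field) at a point.
\<close>

definition Phi ::
    "nat \<Rightarrow> ('n \<Rightarrow> 'n \<Rightarrow> 'n \<Rightarrow> real) \<Rightarrow> ('n list \<Rightarrow> real) \<Rightarrow> 'n::{finite, linorder} \<Rightarrow> 'n list \<Rightarrow> real" where
  "Phi p \<Gamma> F j = ext_coeffs dx p (\<lambda>w. \<Sum>I\<in>multi_indices p. \<Sum>h<p. \<Sum>i\<in>UNIV.
     \<Gamma> (I ! h) j i * F I * wedge (map dx (I[h := i])) w)"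

definition Phi_bar ::
    "nat \<Rightarrow> ('n \<Rightarrow> 'n \<Rightarrow> 'n \<Rightarrow> real) \<Rightarrow> ('n list \<Rightarrow> real) \<Rightarrow> 'n::{finite, linorder} \<Rightarrow> 'n list \<Rightarrow> real" where
  "Phi_bar q \<Gamma> F j = ext_coeffs ddx q (\<lambda>w. \<Sum>I\<in>multi_indices q. \<Sum>h<q. \<Sum>i\<in>UNIV.
     \<Gamma> i j (I ! h) * F I * wedge (map ddx (I[h := i])) w)"

lemma finite_multi_indices [simp]: "finite (multi_indices p :: 'n::{finite, linorder} list set)"
  unfolding multi_indices_def
  by (rule finite_subset[OF _ finite_lists_length_eq[of "UNIV :: 'n set" p]]) auto

lemma wedge_permute:
  assumes \<tau>: "\<tau> permutes {..<length as}"
  shows "wedge (permute_list \<tau> as) w = of_int (sign \<tau>) * wedge as w"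
proof -
  let ?S = "{..<length as}"
  let ?f = "\<lambda>\<sigma>. of_int (sign \<sigma>) * (\<Prod>h<length as. (as ! h) (w (\<sigma> h)))"
  have perm: "permutation \<pi>" if "\<pi> permutes ?S" for \<pi>
    using that by (auto simp: permutation_permutes)
  have "wedge (permute_list \<tau> as) w =
      (\<Sum>\<sigma> | \<sigma> permutes ?S. of_int (sign \<sigma>) * (\<Prod>h<length as. (as ! \<tau> h) (w (\<sigma> h))))"
    using \<tau> by (auto simp: wedge_def permute_list_nth intro!: sum.cong prod.cong)
  also have "\<dots> = (\<Sum>\<sigma> | \<sigma> permutes ?S.
      of_int (sign (\<sigma> \<circ> \<tau>)) * (\<Prod>h<length as. (as ! \<tau> h) (w ((\<sigma> \<circ> \<tau>) h))))"
    by (rule sum_permutations_compose_right[OF \<tau>])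
  also have "\<dots> = (\<Sum>\<sigma> | \<sigma> permutes ?S. of_int (sign \<tau>) * ?f \<sigma>)"
  proof (rule sum.cong[OF refl])
    fix \<sigma> assume "\<sigma> \<in> {\<sigma>. \<sigma> permutes ?S}"
    then have \<sigma>: "\<sigma> permutes ?S" by simp
    have "(\<Prod>h<length as. (as ! \<tau> h) (w ((\<sigma> \<circ> \<tau>) h))) = (\<Prod>h<length as. (as ! h) (w (\<sigma> h)))"
      using prod.permute[OF \<tau>, of "\<lambda>h. (as ! h) (w (\<sigma> h))"] by (simp add: o_def)
    then show "of_int (sign (\<sigma> \<circ> \<tau>)) * (\<Prod>h<length as. (as ! \<tau> h) (w ((\<sigma> \<circ> \<tau>) h)))
        = of_int (sign \<tau>) * ?f \<sigma>"
      using sign_compose[OF perm[OF \<sigma>] perm[OF \<tau>]] by simp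
  qed
  finally show ?thesis
    by (simp add: wedge_def sum_distrib_left)
qed

lemma wedge_not_distinct:
  assumes "\<not> distinct as"
  shows "wedge as w = 0"
proof -
  obtain a b where ab: "a < length as" "b < length as" "a \<noteq> b" "as ! a = as ! b"
    using assms by (auto simp: distinct_conv_nth)
  let ?\<tau> = "Transposition.transpose a b"
  have \<tau>: "?\<tau> permutes {..<length as}"
    using ab by (intro permutes_swap_id) auto
  have "permute_list ?\<tau> as = as"
    using ab \<tau> by (intro nth_equalityI) (auto simp: permute_list_nth Transposition.transpose_def)
  then show ?thesis
    using wedge_permute[OF \<tau>, of w] ab by (simp add: sign_swap_id)
qed

lemma wedge_basis_coeff:
  fixes e :: "'n::{finite, linorder} \<Rightarrow> 'v \<Rightarrow> real"
  assumes K: "length K = p"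
  shows "\<exists>\<phi>. is_ext_coeffs e p (\<lambda>w. c * wedge (map e K) w) \<phi>"
proof (cases "distinct K")
  case False
  then have "wedge (map e K) w = 0" for w
    by (intro wedge_not_distinct) (auto simp: distinct_map)
  then show ?thesis
    by (intro exI[of _ "\<lambda>_. 0"]) (auto simp: is_ext_coeffs_def)
next
  case True
  define J where "J = sort K"
  have J: "J \<in> multi_indices p"
    using True K by (auto simp: J_def multi_indices_def strict_sorted_iff)
  obtain \<tau> where \<tau>: "\<tau> permutes {..<length J}" "permute_list \<tau> J = K"
    using mset_eq_permutation[of K J] by (auto simp: J_def)
  have "wedge (map e K) w = of_int (sign \<tau>) * wedge (map e J) w" for w
    using wedge_permute[of \<tau> "map e J" w] \<tau> by (simp add: permute_list_map)
  then show ?thesis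
    using J by (intro exI[of _ "\<lambda>L. if L = J then c * of_int (sign \<tau>) else 0"])
      (auto simp: is_ext_coeffs_def if_distrib[of "\<lambda>x. x * _"] sum.delta cong: if_cong)
qed

lemma is_ext_coeffs_sum:
  assumes "finite S" "\<And>s. s \<in> S \<Longrightarrow> \<exists>\<phi>. is_ext_coeffs e p (T s) \<phi>"
  shows "\<exists>\<phi>. is_ext_coeffs e p (\<lambda>w. \<Sum>s\<in>S. T s w) \<phi>"
proof -
  obtain \<phi> where \<phi>: "\<And>s. s \<in> S \<Longrightarrow> is_ext_coeffs e p (T s) (\<phi> s)"
    using assms(2) by metis
  have "(\<Sum>J\<in>multi_indices p. (\<Sum>s\<in>S. \<phi> s J) * wedge (map e J) w) = (\<Sum>s\<in>S. T s w)" for w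
  proof -
    have "(\<Sum>J\<in>multi_indices p. (\<Sum>s\<in>S. \<phi> s J) * wedge (map e J) w)
        = (\<Sum>s\<in>S. \<Sum>J\<in>multi_indices p. \<phi> s J * wedge (map e J) w)"
      unfolding sum_distrib_right by (rule sum.swap)
    also have "\<dots> = (\<Sum>s\<in>S. T s w)"
      using \<phi> by (intro sum.cong) (auto simp: is_ext_coeffs_def)
    finally show ?thesis .
  qed
  then show ?thesis
    using \<phi> by (intro exI[of _ "\<lambda>J. \<Sum>s\<in>S. \<phi> s J"]) (auto simp: is_ext_coeffs_def)
qed

lemma wedge_dual:
  fixes e :: "'n::{finite, linorder} \<Rightarrow> 'v \<Rightarrow> real"
  assumes dual: "\<And>i k. e i (b k) = (if i = k then 1 else 0)"
    and I: "I \<in> multi_indices p" and J: "J \<in> multi_indices p"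
  shows "wedge (map e I) (\<lambda>h. b (J ! h)) = (if I = J then 1 else 0)"
proof -
  have len: "length I = p" "length J = p" and srt: "sorted_wrt (<) I" "sorted_wrt (<) J"
    using I J by (auto simp: multi_indices_def)
  have *: "(\<Prod>h<p. e (I ! h) (b (J ! \<sigma> h))) = (if I = J \<and> \<sigma> = id then 1 else 0)"
    if \<sigma>: "\<sigma> permutes {..<p}" for \<sigma>
  proof (cases "\<forall>h<p. I ! h = J ! \<sigma> h")
    case True
    then have "I = permute_list \<sigma> J"
      using \<sigma> len by (intro nth_equalityI) (auto simp: permute_list_nth)
    then have "mset I = mset J"
      using \<sigma> len by simp
    then have IJ: "I = J"
      using srt by (meson strict_sorted_equal mset_eq_setD)
    have "\<sigma> h = h" for h
    proof (cases "h < p")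
      case h: True
      then have "\<sigma> h < p" using permutes_in_image[OF \<sigma>, of h] by simp
      then show ?thesis
        using True IJ h len srt by (metis nth_eq_iff_index_eq strict_sorted_iff)
    next
      case False
      then show ?thesis using \<sigma> by (simp add: permutes_def)
    qed
    then show ?thesis using True IJ dual by auto
  next
    case False
    then obtain h where "h < p" "I ! h \<noteq> J ! \<sigma> h" by auto
    then have "(\<Prod>h<p. e (I ! h) (b (J ! \<sigma> h))) = 0"
      using dual by (intro prod_zero) auto
    then show ?thesis using False by auto
  qed
  have "wedge (map e I) (\<lambda>h. b (J ! h)) =
      (\<Sum>\<sigma> | \<sigma> permutes {..<p}. of_int (sign \<sigma>) * (if I = J \<and> \<sigma> = id then 1 else 0))"
    using * len by (auto simp: wedge_def intro!: sum.cong)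
  also have "\<dots> = (\<Sum>\<sigma> | \<sigma> permutes {..<p}. if \<sigma> = id then (if I = J then 1 else 0) else 0)"
    by (intro sum.cong) auto
  also have "\<dots> = (if I = J then 1 else 0)"
    by (simp add: sum.delta finite_permutations permutes_id)
  finally show ?thesis .
qed

lemma ext_coeffs_eqI:
  fixes e :: "'n::{finite, linorder} \<Rightarrow> 'v \<Rightarrow> real"
  assumes dual: "\<And>i k. e i (b k) = (if i = k then 1 else 0)"
    and \<phi>: "is_ext_coeffs e p T \<phi>"
  shows "ext_coeffs e p T = \<phi>"
proof -
  have eval: "\<psi> J = T (\<lambda>h. b (J ! h))"
    if \<psi>: "is_ext_coeffs e p T \<psi>" and J: "J \<in> multi_indices p" for \<psi> J
  proof -
    have "T (\<lambda>h. b (J ! h)) = (\<Sum>I\<in>multi_indices p. \<psi> I * wedge (map e I) (\<lambda>h. b (J ! h)))"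
      using \<psi> by (auto simp: is_ext_coeffs_def)
    also have "\<dots> = (\<Sum>I\<in>multi_indices p. if I = J then \<psi> J else 0)"
      using wedge_dual[of e b, OF dual _ J] by (intro sum.cong) auto
    finally show ?thesis using J by (simp add: sum.delta)
  qed
  show ?thesis
    unfolding ext_coeffs_def
  proof (rule the_equality[of "is_ext_coeffs e p T", OF \<phi>])
    fix \<psi> assume \<psi>: "is_ext_coeffs e p T \<psi>"
    show "\<psi> = \<phi>"
    proof
      fix J show "\<psi> J = \<phi> J"
        using eval[OF \<phi>] eval[OF \<psi>] \<phi> \<psi>
        by (cases "J \<in> multi_indices p") (auto simp: is_ext_coeffs_def)
    qed
  qed
qed

lemma dx_axis: "dx i (axis k 1) = (if i = k then 1 else 0)"
  by (auto simp: dx_def axis_def)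

lemma ddx_dual:
  "ddx i (Blinfun (\<lambda>w :: real^'n. w $ k)) = (if i = k then 1 else 0)" for i k :: "'n::finite"
  by (auto simp: ddx_def axis_def bounded_linear_Blinfun_apply bounded_linear_vec_nth)

lemma is_ext_coeffs_ext_coeffs:
  fixes e :: "'n::{finite, linorder} \<Rightarrow> 'v \<Rightarrow> real"
  assumes dual: "\<And>i k. e i (b k) = (if i = k then 1 else 0)"
    and ex: "\<exists>\<phi>. is_ext_coeffs e p T \<phi>"
  shows "is_ext_coeffs e p T (ext_coeffs e p T)"
proof -
  obtain \<phi> where \<phi>: "is_ext_coeffs e p T \<phi>"
    using ex by blast
  show ?thesis
    unfolding ext_coeffs_eqI[of e b p T \<phi>, OF dual \<phi>] by (rule \<phi>)
qed

lemma Phi_expansion: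
  "is_ext_coeffs dx p (\<lambda>w. \<Sum>I\<in>multi_indices p. \<Sum>h<p. \<Sum>i\<in>UNIV.
     \<Gamma> (I ! h) j i * F I * wedge (map dx (I[h := i])) w) (Phi p \<Gamma> F j)"
  unfolding Phi_def
  by (rule is_ext_coeffs_ext_coeffs[of dx "\<lambda>k. axis k 1", OF dx_axis],
      intro is_ext_coeffs_sum wedge_basis_coeff finite_multi_indices) (auto simp: multi_indices_def)

lemma Phi_bar_expansion:
  "is_ext_coeffs ddx q (\<lambda>w. \<Sum>I\<in>multi_indices q. \<Sum>h<q. \<Sum>i\<in>UNIV.
     \<Gamma> i j (I ! h) * F I * wedge (map ddx (I[h := i])) w) (Phi_bar q \<Gamma> F j)"
  unfolding Phi_bar_def
  by (rule is_ext_coeffs_ext_coeffs[of ddx "\<lambda>k. Blinfun (\<lambda>w. w $ k)", OF ddx_dual],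
      intro is_ext_coeffs_sum wedge_basis_coeff finite_multi_indices) (auto simp: multi_indices_def)


section \<open>The two kinds of systems\<close>

text \<open>In a matrix \<open>V :: real^'n^'n\<close>, the entry \<open>V $ a $ b\<close> has upper index \<open>a\<close> and lower index \<open>b\<close>.\<close>

definition jacobian ::
    "('m, 'n::finite) chart \<Rightarrow> ('m \<Rightarrow> 'n rvec) \<Rightarrow> 'm \<Rightarrow> 'n sqmat" where
  "jacobian c u m = (\<chi> b j. coord_deriv c j (\<lambda>m'. u m' $ b) m)"

definition Gamma_u ::
    "('m, 'n::finite) chart \<Rightarrow> ('m \<Rightarrow> 'n rvec) \<Rightarrow> 'm \<Rightarrow> 'n \<Rightarrow> 'n \<Rightarrow> 'n \<Rightarrow> real" where
  "Gamma_u ch u m a c d = (\<Sum>b\<in>UNIV. matrix_inv (jacobian ch u m) $ a $ b *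
     coord_deriv ch c (coord_deriv ch d (\<lambda>m'. u m' $ b)) m)"

definition Gamma_V ::
    "('m, 'n::finite) chart \<Rightarrow> ('m \<Rightarrow> 'n sqmat) \<Rightarrow> 'm \<Rightarrow> 'n \<Rightarrow> 'n \<Rightarrow> 'n \<Rightarrow> real" where
  "Gamma_V ch V m a c d = - (\<Sum>b\<in>UNIV. coord_deriv ch d (\<lambda>m'. V m' $ a $ b) m *
     matrix_inv (V m) $ b $ c)"

definition Psi ::
    "nat \<Rightarrow> ('m, 'n) chart \<Rightarrow> ('m \<Rightarrow> 'n sqmat) \<Rightarrow> ('n list \<Rightarrow> 'm \<Rightarrow> real) \<Rightarrow> 'm \<Rightarrow>
      'n::{finite, linorder} \<Rightarrow> 'n list \<Rightarrow> real" where
  "Psi p ch V F m = Phi p (Gamma_V ch V m) (\<lambda>I. F I m)"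

definition Psi_bar ::
    "nat \<Rightarrow> ('m, 'n) chart \<Rightarrow> ('m \<Rightarrow> 'n sqmat) \<Rightarrow> ('n list \<Rightarrow> 'm \<Rightarrow> real) \<Rightarrow> 'm \<Rightarrow>
      'n::{finite, linorder} \<Rightarrow> 'n list \<Rightarrow> real" where
  "Psi_bar q ch V F m = Phi_bar q (Gamma_V ch V m) (\<lambda>I. F I m)"

text \<open>The condition that the 2-jet of \<open>u\<close> at \<open>m\<close> lies in the bundle \<open>O\<^sup>2\<close>.\<close>

definition jet_in_O2 ::
    "('m, 'n::{finite, linorder}) chart \<Rightarrow> ('m \<Rightarrow> 'n rvec) \<Rightarrow> 'm \<Rightarrow> bool" where
  "jet_in_O2 ch u m \<longleftrightarrow>
     wedge (map (\<lambda>b. differential ch (\<lambda>m'. u m' $ b) m) (sorted_list_of_set UNIV)) \<noteq> (\<lambda>_. 0)"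

definition local_O2_map ::
    "('m::{t2_space, second_countable_topology}, 'n::{finite, linorder}) chart set \<Rightarrow> ('m, 'n) chart \<Rightarrow>
      'm set \<Rightarrow> ('m \<Rightarrow> 'n rvec) \<Rightarrow> bool" where
  "local_O2_map A ch W u \<longleftrightarrow> open W \<and> W \<subseteq> fst ch \<and>
     (\<forall>b. smooth_fun_on A W (\<lambda>m. u m $ b)) \<and> (\<forall>m\<in>W. jet_in_O2 ch u m)"

definition local_GL_map ::
    "('m::{t2_space, second_countable_topology}, 'n::finite) chart set \<Rightarrow> ('m, 'n) chart \<Rightarrow>
      'm set \<Rightarrow> ('m \<Rightarrow> 'n sqmat) \<Rightarrow> bool" where
  "local_GL_map A ch W V \<longleftrightarrow> open W \<and> W \<subseteq> fst ch \<and>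
     (\<forall>a b. smooth_fun_on A W (\<lambda>m. V m $ a $ b)) \<and> (\<forall>m\<in>W. invertible (V m))"

definition commutation_equations ::
    "('m, 'n::{finite, linorder}) chart \<Rightarrow> ('m \<Rightarrow> 'n sqmat) \<Rightarrow> 'm \<Rightarrow> bool" where
  "commutation_equations ch V x \<longleftrightarrow> (\<forall>k l m. l < m \<longrightarrow>
     (\<Sum>j\<in>UNIV. V x $ j $ m * coord_deriv ch j (\<lambda>y. V y $ k $ l) x) =
     (\<Sum>i\<in>UNIV. coord_deriv ch i (\<lambda>y. V y $ k $ m) x * V x $ i $ l))"

definition solves_second_order_form where
  "solves_second_order_form A ch p F W u \<longleftrightarrow> local_O2_map A ch W u \<and>
     (\<forall>m\<in>W. \<forall>J\<in>multi_indices p. \<forall>j.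
        coord_deriv ch j (F J) m = Phi p (Gamma_u ch u m) (\<lambda>I. F I m) j J)"

definition solves_first_order_form where
  "solves_first_order_form A ch p F W V \<longleftrightarrow> local_GL_map A ch W V \<and>
     (\<forall>m\<in>W. \<forall>J\<in>multi_indices p. \<forall>j. coord_deriv ch j (F J) m = Psi p ch V F m j J) \<and>
     (\<forall>m\<in>W. commutation_equations ch V m)"

definition solves_second_order_multivector where
  "solves_second_order_multivector A ch q F W u \<longleftrightarrow> local_O2_map A ch W u \<and>
     (\<forall>m\<in>W. \<forall>J\<in>multi_indices q. \<forall>j.
        coord_deriv ch j (F J) m = - Phi_bar q (Gamma_u ch u m) (\<lambda>I. F I m) j J)"

definition solves_first_order_multivector where
  "solves_first_order_multivector A ch q F W V \<longleftrightarrow> local_GL_map A ch W V \<and>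
     (\<forall>m\<in>W. \<forall>J\<in>multi_indices q. \<forall>j. coord_deriv ch j (F J) m = - Psi_bar q ch V F m j J) \<and>
     (\<forall>m\<in>W. commutation_equations ch V m)"

definition equivalent_systems ::
    "('m::topological_space, 'n::finite) chart \<Rightarrow> ('m set \<Rightarrow> ('m \<Rightarrow> 'n rvec) \<Rightarrow> bool) \<Rightarrow>
      ('m set \<Rightarrow> ('m \<Rightarrow> 'n sqmat) \<Rightarrow> bool) \<Rightarrow> bool" where
  "equivalent_systems ch solves2 solves1 \<longleftrightarrow>
     (\<forall>W u. solves2 W u \<longrightarrow> solves1 W (\<lambda>m. matrix_inv (jacobian ch u m))) \<and>
     (\<forall>W V. solves1 W V \<longrightarrow> (\<forall>m\<in>W. \<exists>W' u. open W' \<and> m \<in> W' \<and> W' \<subseteq> W \<and> solves2 W' u \<and>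
        (\<forall>m'\<in>W'. V m' = matrix_inv (jacobian ch u m'))))"

end

theory Submission
  imports Defs
begin

text \<open>
  Let \<open>V\<close> be the inverse of the Jacobian matrix \<open>J\<close> of \<open>u\<close>. Differentiating \<open>V J = 1\<close> turns
  \<open>\<Gamma>\<^sup>a\<^sub>c\<^sub>d = \<Sum>\<^sub>b v\<^sup>a\<^sub>b \<partial>\<^sub>c\<partial>\<^sub>d u\<^sup>b\<close> into \<open>- \<Sum>\<^sub>b (\<partial>\<^sub>c v\<^sup>a\<^sub>b) J\<^sup>b\<^sub>d\<close>, which is the expression in \<open>V\<close>
  up to the order of the lower indices. For an arbitrary \<open>V\<close>, the commutation equations say exactly
  that this expression is symmetric in \<open>c\<close> and \<open>d\<close>. For \<open>V = J\<^sup>-\<^sup>1\<close> the symmetry is that of second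
  derivatives. Conversely, symmetry means that the rows of \<open>V\<^sup>-\<^sup>1\<close> are closed 1-forms, and by
  the Poincare lemma on a ball they are the differentials of functions \<open>u\<^sup>1, \<dots>, u\<^sup>n\<close>.
\<close>

section \<open>Partial derivatives and smooth functions\<close>

lemma partial_deriv_eqI:
  assumes "(f has_derivative D) (at y)"
  shows "partial_deriv j f y = D (axis j 1)"
  using frechet_derivative_at[OF assms] by (simp add: partial_deriv_def)

lemma has_derivative_partial_deriv:
  fixes f :: "real^'n \<Rightarrow> real"
  assumes "f differentiable at y"
  shows "(f has_derivative (\<lambda>w. \<Sum>j\<in>UNIV. w $ j * partial_deriv j f y)) (at y)"
proof -
  let ?D = "frechet_derivative f (at y)"
  have D: "(f has_derivative ?D) (at y)" and lin: "linear ?D"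
    using assms by (auto simp: frechet_derivative_works linear_frechet_derivative)
  have "?D w = (\<Sum>j\<in>UNIV. w $ j * partial_deriv j f y)" for w
  proof -
    have "?D w = ?D (\<Sum>j\<in>UNIV. w $ j *s axis j 1)"
      by (simp add: basis_expansion)
    also have "\<dots> = (\<Sum>j\<in>UNIV. w $ j * partial_deriv j f y)"
      using lin by (simp add: linear_sum linear_cmul scalar_mult_eq_scaleR partial_deriv_def)
    finally show ?thesis .
  qed
  then have "?D = (\<lambda>w. \<Sum>j\<in>UNIV. w $ j * partial_deriv j f y)" ..
  with D show ?thesis by metis
qed

lemma partial_deriv_cong:
  assumes "open S" "y \<in> S" and eq: "\<And>z. z \<in> S \<Longrightarrow> f z = g z"
  shows "partial_deriv j f y = partial_deriv j g y"
proof -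
  have "(f has_derivative D) (at y) \<longleftrightarrow> (g has_derivative D) (at y)" for D
    using has_derivative_transform_within_open[OF _ assms(1,2)] eq by metis
  then show ?thesis
    by (simp add: partial_deriv_def frechet_derivative_def)
qed

lemma partial_deriv_const [simp]: "partial_deriv j (\<lambda>_. c) = (\<lambda>_. 0)"
  by (simp add: partial_deriv_def fun_eq_iff)

lemma partial_deriv_mult:
  assumes "f differentiable at y" "g differentiable at y"
  shows "partial_deriv j (\<lambda>z. f z * g z) y = partial_deriv j f y * g y + f y * partial_deriv j g y"
  using assms unfolding frechet_derivative_works
  by (subst partial_deriv_eqI[OF has_derivative_mult]) (auto simp: partial_deriv_def)

lemma partial_deriv_sum:
  assumes "\<And>s. s \<in> I \<Longrightarrow> f s differentiable at y"
  shows "partial_deriv j (\<lambda>z. \<Sum>s\<in>I. f s z) y = (\<Sum>s\<in>I. partial_deriv j (f s) y)"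
  using assms unfolding frechet_derivative_works
  by (subst partial_deriv_eqI[OF has_derivative_sum]) (auto simp: partial_deriv_def)

lemma partial_deriv_inverse:
  assumes "f differentiable at y" "f y \<noteq> 0"
  shows "partial_deriv j (\<lambda>z. inverse (f z)) y = (- 1 * partial_deriv j f y) * (inverse (f y) * inverse (f y))"
  using assms unfolding frechet_derivative_works
  by (subst partial_deriv_eqI[OF Deriv.has_derivative_inverse]) (auto simp: partial_deriv_def)

lemma partial_deriv_compose:
  fixes f :: "real^'n \<Rightarrow> real" and g :: "real^'n \<Rightarrow> real^'n"
  assumes "\<And>i. (\<lambda>z. g z $ i) differentiable at y" "f differentiable at (g y)"
  shows "(\<lambda>z. f (g z)) differentiable at y"
    and "partial_deriv j (\<lambda>z. f (g z)) y
      = (\<Sum>i\<in>UNIV. partial_deriv i f (g y) * partial_deriv j (\<lambda>z. g z $ i) y)"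
proof -
  let ?G = "\<lambda>w. \<chi> i. frechet_derivative (\<lambda>z. g z $ i) (at y) w"
  have G: "(g has_derivative ?G) (at y)"
  proof (subst has_derivative_componentwise_within, intro ballI)
    fix b :: "real^'n" assume "b \<in> Basis"
    then obtain i where b: "b = axis i 1" by (auto simp: Basis_vec_def)
    then show "((\<lambda>x. g x \<bullet> b) has_derivative (\<lambda>x. ?G x \<bullet> b)) (at y)"
      using assms(1)[of i] by (simp add: frechet_derivative_works inner_axis)
  qed
  have "((\<lambda>z. f (g z)) has_derivative
      (\<lambda>w. \<Sum>i\<in>UNIV. ?G w $ i * partial_deriv i f (g y))) (at y)"
    using diff_chain_at[OF G has_derivative_partial_deriv[OF assms(2)]] by (simp add: o_def)
  from differentiableI[OF this] partial_deriv_eqI[OF this, of j]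
  show "(\<lambda>z. f (g z)) differentiable at y"
    and "partial_deriv j (\<lambda>z. f (g z)) y
      = (\<Sum>i\<in>UNIV. partial_deriv i f (g y) * partial_deriv j (\<lambda>z. g z $ i) y)"
    by (simp_all add: partial_deriv_def mult.commute)
qed

lemma Ck_on_SucD: "Ck_on (Suc k) S f \<Longrightarrow> Ck_on k S f"
proof (induction k arbitrary: f)
  case 0
  then show ?case by (auto intro: differentiable_imp_continuous_on)
next
  case (Suc k)
  then show ?case by (metis Ck_on.simps(2))
qed

lemma Ck_on_subset: "Ck_on k S f \<Longrightarrow> T \<subseteq> S \<Longrightarrow> Ck_on k T f"
  by (induction k arbitrary: f) (auto intro: continuous_on_subset differentiable_on_subset)

lemma Ck_on_cong:
  assumes "open S" "\<And>y. y \<in> S \<Longrightarrow> f y = g y" "Ck_on k S f"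
  shows "Ck_on k S g"
  using assms(2,3)
proof (induction k arbitrary: f g)
  case 0
  then show ?case by (simp cong: continuous_on_cong)
next
  case (Suc k)
  have "g differentiable at y" if "y \<in> S" for y
  proof -
    have "f differentiable at y"
      using Suc.prems(2) that \<open>open S\<close> by (simp add: differentiable_on_eq_differentiable_at)
    then obtain D where D: "(f has_derivative D) (at y)"
      by (auto simp: differentiable_def)
    have "(g has_derivative D) (at y)"
      by (rule has_derivative_transform_within_open[OF D \<open>open S\<close> that Suc.prems(1)])
    then show ?thesis by (rule differentiableI)
  qed
  moreover have "Ck_on k S (partial_deriv j g)" for j
  proof (rule Suc.IH)
    show "partial_deriv j f y = partial_deriv j g y" if "y \<in> S" for y
      by (rule partial_deriv_cong[OF \<open>open S\<close> that Suc.prems(1)])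
    show "Ck_on k S (partial_deriv j f)"
      using Suc.prems(2) by simp
  qed
  ultimately show ?case
    using \<open>open S\<close> by (auto simp: differentiable_on_eq_differentiable_at)
qed

lemma Ck_on_const: "Ck_on k S (\<lambda>_. c)"
  by (induction k arbitrary: c) auto

lemma Ck_on_Suc_differentiable:
  "open S \<Longrightarrow> Ck_on (Suc k) S f \<Longrightarrow> y \<in> S \<Longrightarrow> f differentiable at y"
  by (auto simp: differentiable_on_eq_differentiable_at)

lemma Ck_on_sum:
  assumes "open S" "\<And>s. s \<in> I \<Longrightarrow> Ck_on k S (f s)"
  shows "Ck_on k S (\<lambda>y. \<Sum>s\<in>I. f s y)"
  using assms(2)
proof (induction k arbitrary: f)
  case 0
  then show ?case by (auto intro: continuous_on_sum)
next
  case (Suc k)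
  note d = Ck_on_Suc_differentiable[OF \<open>open S\<close> Suc.prems]
  have "Ck_on k S (partial_deriv j (\<lambda>y. \<Sum>s\<in>I. f s y))" for j
  proof (rule Ck_on_cong[OF \<open>open S\<close>])
    show "Ck_on k S (\<lambda>y. \<Sum>s\<in>I. partial_deriv j (f s) y)"
      using Suc.prems by (intro Suc.IH) simp
    show "(\<Sum>s\<in>I. partial_deriv j (f s) y) = partial_deriv j (\<lambda>y. \<Sum>s\<in>I. f s y) y"
      if "y \<in> S" for y
      by (rule partial_deriv_sum[symmetric]) (rule d[OF _ that])
  qed
  moreover have "(\<lambda>y. \<Sum>s\<in>I. f s y) differentiable at y" if "y \<in> S" for y
    using d[OF _ that] by (cases "finite I") (simp_all add: differentiable_sum)
  ultimately show ?case
    using \<open>open S\<close> by (simp add: differentiable_on_eq_differentiable_at)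
qed

lemma Ck_on_add:
  assumes "open S" "Ck_on k S f" "Ck_on k S g"
  shows "Ck_on k S (\<lambda>y. f y + g y)"
  using Ck_on_sum[OF \<open>open S\<close>, of UNIV k "\<lambda>b :: bool. if b then f else g"] assms
  by (simp add: UNIV_bool add.commute)

lemma Ck_on_mult:
  assumes "open S" "Ck_on k S f" "Ck_on k S g"
  shows "Ck_on k S (\<lambda>y. f y * g y)"
  using assms(2,3)
proof (induction k arbitrary: f g)
  case 0
  then show ?case by (auto intro: continuous_on_mult)
next
  case (Suc k)
  note d = Suc.prems[THEN Ck_on_Suc_differentiable[OF \<open>open S\<close>]]
  have "Ck_on k S (partial_deriv j (\<lambda>y. f y * g y))" for j
  proof (rule Ck_on_cong[OF \<open>open S\<close>])
    show "Ck_on k S (\<lambda>y. partial_deriv j f y * g y + f y * partial_deriv j g y)"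
      using Suc.prems Suc.prems[THEN Ck_on_SucD]
      by (intro Ck_on_add[OF \<open>open S\<close>] Suc.IH) simp_all
  qed (simp add: partial_deriv_mult d)
  then show ?case
    using Suc.prems by (auto intro: differentiable_on_mult)
qed

lemma Ck_on_prod:
  assumes "open S" "finite I" "\<And>s. s \<in> I \<Longrightarrow> Ck_on k S (f s)"
  shows "Ck_on k S (\<lambda>y. \<Prod>s\<in>I. f s y)"
  using assms(2,3)
  by (induction I rule: finite_induct) (auto intro: Ck_on_mult[OF \<open>open S\<close>] Ck_on_const)

lemma Ck_on_inverse:
  assumes "open S" "Ck_on k S f" "\<And>y. y \<in> S \<Longrightarrow> f y \<noteq> 0"
  shows "Ck_on k S (\<lambda>y. inverse (f y))"
  using assms(2,3)
proof (induction k arbitrary: f)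
  case 0
  then show ?case by (auto intro: continuous_on_inverse)
next
  case (Suc k)
  note d = Ck_on_Suc_differentiable[OF \<open>open S\<close> Suc.prems(1)]
  have "Ck_on k S (partial_deriv j (\<lambda>y. inverse (f y)))" for j
  proof (rule Ck_on_cong[OF \<open>open S\<close>])
    show "Ck_on k S (\<lambda>y. (- 1 * partial_deriv j f y) * (inverse (f y) * inverse (f y)))"
      using Suc.prems Suc.IH[OF Ck_on_SucD[OF Suc.prems(1)]]
      by (intro Ck_on_mult[OF \<open>open S\<close>] Ck_on_const) simp_all
  qed (simp add: partial_deriv_inverse d Suc.prems(2))
  then show ?case
    using Suc.prems by (auto intro: differentiable_on_inverse)
qed

lemma Ck_on_compose:
  fixes f :: "real^'n \<Rightarrow> real" and g :: "real^'n \<Rightarrow> real^'n"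
  assumes "open S" "open T" "g ` S \<subseteq> T"
    and "Ck_on k T f" "\<And>i. Ck_on k S (\<lambda>y. g y $ i)"
  shows "Ck_on k S (\<lambda>y. f (g y))"
  using assms(4,5)
proof (induction k arbitrary: f)
  case 0
  have "continuous_on S (\<lambda>y. \<chi> i. g y $ i)"
    using 0 by (intro continuous_on_vec_lambda) auto
  then have "continuous_on S g" by simp
  then show ?case
    using 0 assms(3) continuous_on_compose2[of T f S g] by simp
next
  case (Suc k)
  have df: "f differentiable at (g y)" if "y \<in> S" for y
    using Ck_on_Suc_differentiable[OF \<open>open T\<close> Suc.prems(1)] assms(3) that by auto
  note dg = Ck_on_Suc_differentiable[OF \<open>open S\<close> Suc.prems(2)]
  have "Ck_on k S (partial_deriv j (\<lambda>y. f (g y)))" for j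
  proof (rule Ck_on_cong[OF \<open>open S\<close>,
        of "\<lambda>y. \<Sum>i\<in>UNIV. partial_deriv i f (g y) * partial_deriv j (\<lambda>z. g z $ i) y"])
    have "Ck_on k S (\<lambda>y. partial_deriv i f (g y))" for i
      using Suc.prems(1) by (intro Suc.IH[OF _ Ck_on_SucD[OF Suc.prems(2)]]) simp
    then show "Ck_on k S (\<lambda>y. \<Sum>i\<in>UNIV. partial_deriv i f (g y) * partial_deriv j (\<lambda>z. g z $ i) y)"
      using Suc.prems by (intro Ck_on_sum[OF \<open>open S\<close>] Ck_on_mult[OF \<open>open S\<close>]) simp_all
    show "(\<Sum>i\<in>UNIV. partial_deriv i f (g y) * partial_deriv j (\<lambda>z. g z $ i) y)
        = partial_deriv j (\<lambda>y. f (g y)) y" if "y \<in> S" for y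
      by (rule partial_deriv_compose(2)[OF dg[OF that] df[OF that], symmetric])
  qed
  moreover have "(\<lambda>y. f (g y)) differentiable at y" if "y \<in> S" for y
    by (rule partial_deriv_compose(1)[OF dg[OF that] df[OF that]])
  ultimately show ?case
    using \<open>open S\<close> by (simp add: differentiable_on_eq_differentiable_at)
qed

lemma Ck_on_det:
  fixes M :: "real^'n \<Rightarrow> real^'k^'k"
  assumes "open S" "\<And>i j. Ck_on k S (\<lambda>y. M y $ i $ j)"
  shows "Ck_on k S (\<lambda>y. det (M y))"
  unfolding det_def
  using assms by (intro Ck_on_sum Ck_on_mult Ck_on_const Ck_on_prod) auto

lemma matrix_inv_mult:
  fixes M :: "real^'k^'k"
  assumes "det M \<noteq> 0"
  shows "M ** matrix_inv M = mat 1" "matrix_inv M ** M = mat 1"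
proof -
  have "\<exists>B. M ** B = mat 1 \<and> B ** M = mat 1"
    using assms by (simp add: invertible_det_nz[symmetric] invertible_def)
  then have "M ** matrix_inv M = mat 1 \<and> matrix_inv M ** M = mat 1"
    unfolding matrix_inv_def by (rule someI_ex)
  then show "M ** matrix_inv M = mat 1" "matrix_inv M ** M = mat 1" by auto
qed

lemma matrix_inv_eqI:
  fixes M :: "real^'k^'k"
  assumes "M ** B = mat 1"
  shows "matrix_inv M = B"
proof -
  have "det M \<noteq> 0"
    using assms by (metis det_I det_mul mult_zero_left zero_neq_one)
  then have "matrix_inv M ** (M ** B) = B"
    by (simp add: matrix_mul_assoc matrix_inv_mult)
  with assms show ?thesis by simp
qed

lemma Ck_on_matrix_inv:
  fixes M :: "real^'n \<Rightarrow> real^'k^'k"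
  assumes "open S" "\<And>i j. Ck_on k S (\<lambda>y. M y $ i $ j)" "\<And>y. y \<in> S \<Longrightarrow> det (M y) \<noteq> 0"
  shows "Ck_on k S (\<lambda>y. matrix_inv (M y) $ a $ b)"
proof -
  let ?N = "\<lambda>y. \<chi> i j. if j = a then axis b 1 $ i else M y $ i $ j"
  have eq: "det (?N y) * inverse (det (M y)) = matrix_inv (M y) $ a $ b" if "y \<in> S" for y
  proof -
    have "M y *v (matrix_inv (M y) *v axis b 1) = axis b 1"
      using assms(3)[OF that] by (simp add: matrix_vector_mul_assoc matrix_inv_mult)
    then have "matrix_inv (M y) *v axis b 1 =
        (\<chi> k. det (\<chi> i j. if j = k then axis b 1 $ i else M y $ i $ j) / det (M y))"
      using cramer[OF assms(3)[OF that]] by blast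
    then show ?thesis
      by (simp add: vec_eq_iff matrix_vector_mult_basis column_def divide_inverse)
  qed
  have "Ck_on k S (\<lambda>y. ?N y $ i $ j)" for i j
    using assms(2) by (cases "j = a") (simp_all add: Ck_on_const)
  then have "Ck_on k S (\<lambda>y. det (?N y) * inverse (det (M y)))"
    by (intro Ck_on_mult[OF \<open>open S\<close>] Ck_on_det[OF \<open>open S\<close>] Ck_on_inverse[OF \<open>open S\<close>] assms)
  from Ck_on_cong[OF \<open>open S\<close> eq this] show ?thesis .
qed

lemma has_real_derivative_line:
  fixes f :: "real^'n \<Rightarrow> real"
  assumes "f differentiable at (x + s *\<^sub>R axis c 1)"
  shows "((\<lambda>s. f (x + s *\<^sub>R axis c 1)) has_real_derivative partial_deriv c f (x + s *\<^sub>R axis c 1)) (at s)"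
proof -
  let ?y = "x + s *\<^sub>R axis c 1" and ?D = "frechet_derivative f (at (x + s *\<^sub>R axis c 1))"
  have "((\<lambda>s. x + s *\<^sub>R axis c (1::real)) has_derivative (\<lambda>h. h *\<^sub>R axis c 1)) (at s)"
    by (auto intro!: derivative_eq_intros)
  from diff_chain_at[OF this assms[unfolded frechet_derivative_works]]
  have "((\<lambda>s. f (x + s *\<^sub>R axis c 1)) has_derivative (\<lambda>h. ?D (h *\<^sub>R axis c 1))) (at s)"
    by (simp add: o_def)
  moreover have "?D (h *\<^sub>R axis c 1) = partial_deriv c f ?y * h" for h
    using linear_frechet_derivative[OF assms] by (simp add: linear_cmul partial_deriv_def)
  ultimately show ?thesis by (simp add: has_field_derivative_def)
qed

lemma second_difference_mvt:
  fixes f :: "real^'n \<Rightarrow> real"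
  assumes "open S" "Ck_on 2 S f" "0 < h" "ball x (3 * h) \<subseteq> S"
  obtains s t where "0 < s" "s < h" "0 < t" "t < h"
    "f (x + h *\<^sub>R axis c 1 + h *\<^sub>R axis d 1) - f (x + h *\<^sub>R axis c 1) - f (x + h *\<^sub>R axis d 1) + f x
      = h * h * partial_deriv d (partial_deriv c f) (x + s *\<^sub>R axis c 1 + t *\<^sub>R axis d 1)"
proof -
  let ?c = "axis c 1 :: real^'n" and ?d = "axis d 1 :: real^'n"
  have df: "f differentiable at y" "partial_deriv c f differentiable at y" if "y \<in> S" for y
    using that assms(1,2) by (auto simp: numeral_2_eq_2 differentiable_on_eq_differentiable_at)
  have inS: "x + s *\<^sub>R ?c + t *\<^sub>R ?d \<in> S" if "0 \<le> s" "s \<le> h" "0 \<le> t" "t \<le> h" for s t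
  proof -
    have "norm (s *\<^sub>R ?c + t *\<^sub>R ?d) \<le> s + t"
      using that by (intro norm_triangle_le) simp
    then have "dist x (x + s *\<^sub>R ?c + t *\<^sub>R ?d) < 3 * h"
      using that \<open>0 < h\<close> by (simp add: dist_norm norm_minus_commute algebra_simps)
    then show ?thesis using assms(4) by auto
  qed
  have inS0: "x + s *\<^sub>R ?c \<in> S" if "0 \<le> s" "s \<le> h" for s
    using inS[of s 0] that \<open>0 < h\<close> by simp
  define g where "g s = f (x + h *\<^sub>R ?d + s *\<^sub>R ?c) - f (x + s *\<^sub>R ?c)" for s
  have "\<exists>s. 0 < s \<and> s < h \<and> g h - g 0 =
      (h - 0) * (partial_deriv c f (x + h *\<^sub>R ?d + s *\<^sub>R ?c) - partial_deriv c f (x + s *\<^sub>R ?c))"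
    unfolding g_def
    using \<open>0 < h\<close> inS[of _ h] inS0
    by (intro MVT2 DERIV_diff has_real_derivative_line df) (auto simp: algebra_simps)
  then obtain s where s: "0 < s" "s < h" "g h - g 0 =
      h * (partial_deriv c f (x + h *\<^sub>R ?d + s *\<^sub>R ?c) - partial_deriv c f (x + s *\<^sub>R ?c))"
    by auto
  have "\<exists>t. 0 < t \<and> t < h \<and>
      partial_deriv c f (x + s *\<^sub>R ?c + h *\<^sub>R ?d) - partial_deriv c f (x + s *\<^sub>R ?c + 0 *\<^sub>R ?d)
      = (h - 0) * partial_deriv d (partial_deriv c f) (x + s *\<^sub>R ?c + t *\<^sub>R ?d)"
    using \<open>0 < h\<close> inS s
    by (intro MVT2 has_real_derivative_line df) auto
  then obtain t where t: "0 < t" "t < h"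
      "partial_deriv c f (x + s *\<^sub>R ?c + h *\<^sub>R ?d) - partial_deriv c f (x + s *\<^sub>R ?c)
      = h * partial_deriv d (partial_deriv c f) (x + s *\<^sub>R ?c + t *\<^sub>R ?d)"
    by auto
  have "g h - g 0 = h * h * partial_deriv d (partial_deriv c f) (x + s *\<^sub>R ?c + t *\<^sub>R ?d)"
    using s(3) t(3) by (simp add: add_ac)
  then show ?thesis
    using that[OF s(1,2) t(1,2)] by (simp add: g_def add_ac)
qed

lemma partial_deriv_commute:
  fixes f :: "real^'n \<Rightarrow> real"
  assumes "open S" "Ck_on 2 S f" "x \<in> S"
  shows "partial_deriv d (partial_deriv c f) x = partial_deriv c (partial_deriv d f) x"
proof (rule ccontr)
  let ?P = "partial_deriv d (partial_deriv c f)" and ?Q = "partial_deriv c (partial_deriv d f)"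
  assume neq: "?P x \<noteq> ?Q x"
  define e where "e = \<bar>?P x - ?Q x\<bar> / 2"
  have "0 < e" using neq by (simp add: e_def)
  have "continuous (at x) ?P" "continuous (at x) ?Q"
    using assms by (auto simp: numeral_2_eq_2 continuous_on_eq_continuous_at)
  then obtain r1 r2 where r: "0 < r1" "0 < r2"
    "\<And>y. dist y x < r1 \<Longrightarrow> dist (?P y) (?P x) < e" "\<And>y. dist y x < r2 \<Longrightarrow> dist (?Q y) (?Q x) < e"
    using \<open>0 < e\<close> unfolding continuous_at_eps_delta by metis
  obtain r3 where r3: "0 < r3" "ball x r3 \<subseteq> S"
    using assms(1,3) openE by blast
  define h where "h = min (min r1 r2) r3 / 3"
  have h: "0 < h" "3 * h \<le> r1" "3 * h \<le> r2" "3 * h \<le> r3"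
    using r r3 by (auto simp: h_def)
  then have S: "ball x (3 * h) \<subseteq> S" using r3 by auto
  have near: "dist (x + s *\<^sub>R axis a 1 + t *\<^sub>R axis b 1) x < 3 * h"
    if "0 < s" "s < h" "0 < t" "t < h" for s t :: real and a b :: 'n
  proof -
    have "norm (s *\<^sub>R axis a 1 + t *\<^sub>R axis b 1 :: real^'n) \<le> s + t"
      using that by (intro norm_triangle_le) simp
    then show ?thesis using that by (simp add: dist_norm add.assoc)
  qed
  obtain s t where st: "0 < s" "s < h" "0 < t" "t < h" and
    P: "f (x + h *\<^sub>R axis c 1 + h *\<^sub>R axis d 1) - f (x + h *\<^sub>R axis c 1) - f (x + h *\<^sub>R axis d 1) + f x
      = h * h * ?P (x + s *\<^sub>R axis c 1 + t *\<^sub>R axis d 1)"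
    using second_difference_mvt[OF assms(1,2) h(1) S, of c d] by metis
  obtain s' t' where st': "0 < s'" "s' < h" "0 < t'" "t' < h" and
    Q: "f (x + h *\<^sub>R axis d 1 + h *\<^sub>R axis c 1) - f (x + h *\<^sub>R axis d 1) - f (x + h *\<^sub>R axis c 1) + f x
      = h * h * ?Q (x + s' *\<^sub>R axis d 1 + t' *\<^sub>R axis c 1)"
    using second_difference_mvt[OF assms(1,2) h(1) S, of d c] by metis
  have "h * h * ?P (x + s *\<^sub>R axis c 1 + t *\<^sub>R axis d 1) = h * h * ?Q (x + s' *\<^sub>R axis d 1 + t' *\<^sub>R axis c 1)"
    unfolding P[symmetric] Q[symmetric] by (simp add: add_ac)
  then have "?P (x + s *\<^sub>R axis c 1 + t *\<^sub>R axis d 1) = ?Q (x + s' *\<^sub>R axis d 1 + t' *\<^sub>R axis c 1)"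
    using h(1) by simp
  moreover have "dist (?P (x + s *\<^sub>R axis c 1 + t *\<^sub>R axis d 1)) (?P x) < e"
    using near[OF st] h by (intro r(3)) (meson less_le_trans)
  moreover have "dist (?Q (x + s' *\<^sub>R axis d 1 + t' *\<^sub>R axis c 1)) (?Q x) < e"
    using near[OF st'] h by (intro r(4)) (meson less_le_trans)
  ultimately have "\<bar>?P x - ?Q x\<bar> < e + e"
    by (simp add: dist_real_def)
  then show False by (simp add: e_def)
qed

lemma Ck_on_local:
  assumes "open S" "\<And>y. y \<in> S \<Longrightarrow> \<exists>T. open T \<and> y \<in> T \<and> Ck_on k T f"
  shows "Ck_on k S f"
  using assms(2)
proof (induction k arbitrary: f)
  case 0
  then show ?case
    using \<open>open S\<close> by (simp add: continuous_on_eq_continuous_at) (metis continuous_on_eq_continuous_at)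
next
  case (Suc k)
  have "f differentiable at y" if "y \<in> S" for y
    using Suc.prems[OF that] by (auto simp: differentiable_on_eq_differentiable_at)
  moreover have "Ck_on k S (partial_deriv j f)" for j
  proof (rule Suc.IH)
    show "\<exists>T. open T \<and> y \<in> T \<and> Ck_on k T (partial_deriv j f)" if "y \<in> S" for y
      using Suc.prems[OF that] by auto
  qed
  ultimately show ?case
    using \<open>open S\<close> by (simp add: differentiable_on_eq_differentiable_at)
qed

lemma smooth_on_differentiable:
  "open S \<Longrightarrow> smooth_on S f \<Longrightarrow> y \<in> S \<Longrightarrow> f differentiable at y"
  unfolding smooth_on_def by (metis Ck_on_Suc_differentiable)

lemma smooth_on_subset: "smooth_on S f \<Longrightarrow> T \<subseteq> S \<Longrightarrow> smooth_on T f"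
  unfolding smooth_on_def by (metis Ck_on_subset)

lemma closed_form_exact_on_ball:
  fixes B :: "'n \<Rightarrow> real^'n \<Rightarrow> real"
  assumes C1: "\<And>c. Ck_on 1 (ball y0 r) (B c)"
    and closed: "\<And>c d y. y \<in> ball y0 r \<Longrightarrow> partial_deriv d (B c) y = partial_deriv c (B d) y"
  obtains u where "\<And>y. y \<in> ball y0 r \<Longrightarrow> u differentiable at y"
    "\<And>c y. y \<in> ball y0 r \<Longrightarrow> partial_deriv c u y = B c y"
proof -
  let ?U = "ball y0 r"
  define p where "p x t = y0 + t *\<^sub>R (x - y0)" for x :: "real^'n" and t :: real
  have p_in: "p x t \<in> ?U" if "x \<in> ?U" "t \<in> cbox 0 1" for x t
  proof -
    have "norm (t *\<^sub>R (x - y0)) \<le> 1 * norm (x - y0)"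
      using that unfolding norm_scaleR by (intro mult_right_mono) auto
    then show ?thesis using that by (simp add: p_def dist_norm norm_minus_commute)
  qed
  have dB: "B c differentiable at y" if "y \<in> ?U" for c y
    using C1[of c] that by (simp add: differentiable_on_eq_differentiable_at)
  have contB: "continuous_on ?U (B c)" and contB': "continuous_on ?U (partial_deriv d (B c))" for c d
    using C1[of c] by (auto intro: differentiable_imp_continuous_on)
  define f where "f x t = (\<Sum>c\<in>UNIV. B c (p x t) * (x - y0) $ c)" for x t
  define D where "D x t w = (\<Sum>c\<in>UNIV. B c (p x t) * w $ c +
      (\<Sum>d\<in>UNIV. (t *\<^sub>R w) $ d * partial_deriv d (B c) (p x t)) * (x - y0) $ c)" for x t w
  define fx where "fx x t = Blinfun (D x t)" for x t
  have blD: "bounded_linear (D x t)" for x t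
    unfolding linear_conv_bounded_linear[symmetric]
    by (rule linearI) (simp_all add: D_def algebra_simps sum.distrib sum_distrib_left)
  have fx: "blinfun_apply (fx x t) = D x t" for x t
    unfolding fx_def by (rule bounded_linear_Blinfun_apply[OF blD])
  have derf: "((\<lambda>x. f x t) has_derivative blinfun_apply (fx x t)) (at x within ?U)"
    if "x \<in> ?U" "t \<in> cbox 0 1" for x t
  proof -
    have p': "((\<lambda>x. p x t) has_derivative (\<lambda>w. t *\<^sub>R w)) (at x within ?U)"
      unfolding p_def by (auto intro!: derivative_eq_intros)
    have "((\<lambda>x. B c (p x t)) has_derivative
        (\<lambda>w. \<Sum>d\<in>UNIV. (t *\<^sub>R w) $ d * partial_deriv d (B c) (p x t))) (at x within ?U)" for c
      using has_derivative_compose[OF p' has_derivative_partial_deriv[OF dB[OF p_in[OF that]]]]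
      by simp
    moreover have "((\<lambda>x. (x - y0) $ c) has_derivative (\<lambda>w. w $ c)) (at x within ?U)" for c
      by (auto intro!: derivative_eq_intros bounded_linear_imp_has_derivative bounded_linear_vec_nth)
    ultimately show ?thesis
      unfolding fx f_def D_def
      by (auto intro!: has_derivative_sum has_derivative_mult)
  qed
  have cont_p: "continuous_on (?U \<times> cbox 0 1) (\<lambda>z. p (fst z) (snd z))"
    unfolding p_def by (intro continuous_intros)
  have cont_comp: "continuous_on (?U \<times> cbox 0 1) (\<lambda>z. g (p (fst z) (snd z)))"
    if "continuous_on ?U g" for g :: "real^'n \<Rightarrow> real"
    by (rule continuous_on_compose2[OF that cont_p]) (use p_in in auto)
  have cont_fx: "continuous_on (?U \<times> cbox 0 1) (\<lambda>(x, t). fx x t)"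
    unfolding split_beta
  proof (rule continuous_on_blinfun_componentwise)
    fix i :: "real^'n" assume "i \<in> Basis"
    show "continuous_on (?U \<times> cbox 0 1) (\<lambda>z. fx (fst z) (snd z) i)"
      unfolding fx D_def
      by (intro continuous_intros cont_comp contB contB')
  qed
  have cont_f: "continuous_on (cbox 0 1) (f x)" if "x \<in> ?U" for x
  proof -
    have "continuous_on (cbox 0 1) (\<lambda>t. B c (p x t))" for c
      by (rule continuous_on_compose2[OF contB]) (use p_in that in \<open>auto simp: p_def intro!: continuous_intros\<close>)
    then show ?thesis
      unfolding f_def by (intro continuous_intros)
  qed
  let ?u = "\<lambda>x. integral (cbox 0 1) (f x)"
  have deru: "(?u has_derivative integral (cbox 0 1) (fx x)) (at x)" if "x \<in> ?U" for x
    using leibniz_rule[OF derf integrable_continuous[OF cont_f] cont_fx that convex_ball] at_within_open[OF that open_ball]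
    by simp
  have "partial_deriv c ?u x = B c x" if x: "x \<in> ?U" for c x
  proof -
    have "continuous_on (cbox 0 1) (\<lambda>t. fx x t)"
    proof -
      have "continuous_on (cbox 0 1) (\<lambda>t :: real. (x, t))"
        by (intro continuous_intros)
      then have "continuous_on (cbox 0 1) (\<lambda>t. case (x, t) of (x, t) \<Rightarrow> fx x t)"
        by (rule continuous_on_compose2[OF cont_fx]) (use x in auto)
      then show ?thesis by simp
    qed
    then have int: "fx x integrable_on cbox 0 1"
      by (rule integrable_continuous)
    have "((\<lambda>t. D x t (axis c 1)) has_integral 1 * B c (p x 1) - 0 * B c (p x 0)) {0..1}"
    proof (rule fundamental_theorem_of_calculus)
      fix t :: real assume t: "t \<in> {0..1}"
      then have pt: "p x t \<in> ?U" using p_in[OF x] by simp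
      have p': "((\<lambda>t. p x t) has_derivative (\<lambda>h. h *\<^sub>R (x - y0))) (at t within {0..1})"
        unfolding p_def by (auto intro!: derivative_eq_intros)
      have "((\<lambda>t. B c (p x t)) has_derivative
          (\<lambda>h. \<Sum>d\<in>UNIV. (h *\<^sub>R (x - y0)) $ d * partial_deriv d (B c) (p x t))) (at t within {0..1})"
        using has_derivative_compose[OF p' has_derivative_partial_deriv[OF dB[OF pt]]] by simp
      from has_derivative_mult[OF has_derivative_ident this]
      have "((\<lambda>t. t * B c (p x t)) has_derivative (\<lambda>h. t * (\<Sum>d\<in>UNIV. (h *\<^sub>R (x - y0)) $ d *
          partial_deriv d (B c) (p x t)) + h * B c (p x t))) (at t within {0..1})" .
      moreover have "t * (\<Sum>d\<in>UNIV. (h *\<^sub>R (x - y0)) $ d * partial_deriv d (B c) (p x t)) + h * B c (p x t)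
          = h *\<^sub>R D x t (axis c 1)" for h
      proof -
        have "(\<Sum>d\<in>UNIV. B d (p x t) * axis c 1 $ d) = B c (p x t)"
          by (simp add: axis_def if_distrib cong: if_cong)
        moreover have "(\<Sum>e\<in>UNIV. t * axis c 1 $ e * partial_deriv e (B d) (p x t))
            = t * partial_deriv d (B c) (p x t)" for d
          using closed[OF pt, of c d] by (simp add: axis_def if_distrib if_distribR cong: if_cong)
        ultimately have "D x t (axis c 1) = B c (p x t)
            + (\<Sum>d\<in>UNIV. t * partial_deriv d (B c) (p x t) * (x - y0) $ d)"
          by (simp add: D_def sum.distrib)
        then show ?thesis
          by (simp add: algebra_simps sum_distrib_left)
      qed
      ultimately show "((\<lambda>t. t * B c (p x t)) has_vector_derivative D x t (axis c 1)) (at t within {0..1})"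
        by (simp add: has_vector_derivative_def)
    qed simp
    then have "integral (cbox 0 1) (\<lambda>t. D x t (axis c 1)) = B c x"
      by (simp add: p_def integral_unique)
    then show ?thesis
      using partial_deriv_eqI[OF deru[OF x], of c] blinfun_apply_integral[OF int, of "axis c 1"]
      by (simp add: fx)
  qed
  with deru show ?thesis
    by (intro that[of ?u]) (auto intro: differentiableI)
qed

section \<open>Matrices and exterior products\<close>

lemma wedge_sorted_list_eq_det:
  fixes D :: "'n::{finite, linorder} \<Rightarrow> 'v \<Rightarrow> real"
  defines "xs \<equiv> sorted_list_of_set (UNIV :: 'n set)"
  shows "wedge (map D xs) w = det (\<chi> b k. D b (w (inv_into {..<CARD('n)} ((!) xs) k)))"
proof -
  let ?N = "{..<CARD('n)}" and ?f = "(!) xs"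
  let ?g = "inv_into ?N ?f"
  have len: "length xs = CARD('n)" and "distinct xs" and "set xs = UNIV"
    by (simp_all add: xs_def)
  then have bij: "bij_betw ?f ?N UNIV"
    using bij_betw_nth[of xs ?N UNIV] by simp
  then have inj: "inj_on ?f ?N" and im: "?f ` ?N = UNIV"
    by (auto simp: bij_betw_def)
  have bij': "bij_betw ?g UNIV ?N"
    by (rule bij_betw_inv_into[OF bij])
  then have inj': "inj ?g" by (simp add: bij_betw_def)
  have gf: "?g (?f h) = h" if "h < CARD('n)" for h
    using inj that by (simp add: inv_into_f_f)
  have fg: "?f (?g b) = b" for b
    using im by (simp add: f_inv_into_f)
  have "wedge (map D xs) w
      = (\<Sum>\<sigma> | \<sigma> permutes ?N. of_int (sign \<sigma>) * (\<Prod>h<CARD('n). D (xs ! h) (w (\<sigma> h))))"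
    unfolding wedge_def using len by (intro sum.cong prod.cong) auto
  also have "\<dots> = (\<Sum>\<pi> | \<pi> permutes UNIV. of_int (sign \<pi>) * (\<Prod>b\<in>UNIV. D b (w (?g (\<pi> b)))))"
  proof (rule sum.reindex_bij_witness[where i = "map_permutation UNIV ?g" and j = "map_permutation ?N ?f"])
    fix \<sigma> assume "\<sigma> \<in> {\<sigma>. \<sigma> permutes ?N}"
    then have \<sigma>: "\<sigma> permutes ?N" by simp
    show "map_permutation UNIV ?g (map_permutation ?N ?f \<sigma>) = \<sigma>"
      using bij inj' gf \<sigma> by (intro map_permutation_compose_inv) auto
    show "map_permutation ?N ?f \<sigma> \<in> {\<pi>. \<pi> permutes UNIV}"
      using map_permutation_permutes[OF bij \<sigma>] by simp
    have "(\<Prod>b\<in>UNIV. D b (w (?g (map_permutation ?N ?f \<sigma> b))))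
        = (\<Prod>h<CARD('n). D (?f h) (w (?g (map_permutation ?N ?f \<sigma> (?f h)))))"
      by (rule prod.reindex_bij_betw[OF bij, symmetric])
    also have "\<dots> = (\<Prod>h<CARD('n). D (xs ! h) (w (\<sigma> h)))"
    proof (rule prod.cong[OF refl])
      fix h assume "h \<in> ?N"
      moreover then have "\<sigma> h \<in> ?N" using permutes_in_image[OF \<sigma>] by blast
      ultimately have "?g (map_permutation ?N ?f \<sigma> (?f h)) = \<sigma> h"
        by (simp add: map_permutation_def im gf)
      then show "D (?f h) (w (?g (map_permutation ?N ?f \<sigma> (?f h)))) = D (xs ! h) (w (\<sigma> h))"
        by simp
    qed
    finally show "of_int (sign (map_permutation ?N ?f \<sigma>)) *
        (\<Prod>b\<in>UNIV. D b (w (?g (map_permutation ?N ?f \<sigma> b))))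
        = of_int (sign \<sigma>) * (\<Prod>h<CARD('n). D (xs ! h) (w (\<sigma> h)))"
      using sign_map_permutation[OF inj \<sigma>] by simp
  next
    fix \<pi> :: "'n \<Rightarrow> 'n" assume "\<pi> \<in> {\<pi>. \<pi> permutes UNIV}"
    then have \<pi>: "\<pi> permutes UNIV" by simp
    show "map_permutation ?N ?f (map_permutation UNIV ?g \<pi>) = \<pi>"
      using bij' inj fg \<pi> by (intro map_permutation_compose_inv) auto
    show "map_permutation UNIV ?g \<pi> \<in> {\<sigma>. \<sigma> permutes ?N}"
      using map_permutation_permutes[OF bij' \<pi>] by simp
  qed
  finally show ?thesis by (simp add: det_def)
qed

lemma wedge_sorted_list_nonzero_iff:
  fixes D :: "'n::{finite, linorder} \<Rightarrow> 'n rvec \<Rightarrow> real"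
  assumes "\<And>b. linear (D b)"
  shows "wedge (map D (sorted_list_of_set UNIV)) \<noteq> (\<lambda>_. 0) \<longleftrightarrow> det (\<chi> b j. D b (axis j 1)) \<noteq> 0"
proof -
  let ?J = "\<chi> b j. D b (axis j 1)" and ?f = "(!) (sorted_list_of_set (UNIV :: 'n set))"
  let ?g = "inv_into {..<CARD('n)} ?f"
  have expand: "D b v = (\<Sum>j\<in>UNIV. ?J $ b $ j * v $ j)" for b v
  proof -
    have "D b v = D b (\<Sum>j\<in>UNIV. v $ j *s axis j 1)"
      by (simp add: basis_expansion)
    also have "\<dots> = (\<Sum>j\<in>UNIV. ?J $ b $ j * v $ j)"
      using assms by (simp add: linear_sum linear_cmul scalar_mult_eq_scaleR mult.commute)
    finally show ?thesis .
  qed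
  have "wedge (map D (sorted_list_of_set UNIV)) w = det ?J * det (\<chi> j k. w (?g k) $ j)" for w
  proof -
    have "(\<chi> b k. D b (w (?g k))) $ b $ k = (?J ** (\<chi> j k. w (?g k) $ j)) $ b $ k" for b k
      using expand[of b "w (?g k)"] by (simp add: matrix_matrix_mult_def)
    then have "(\<chi> b k. D b (w (?g k))) = ?J ** (\<chi> j k. w (?g k) $ j)"
      by (simp only: vec_eq_iff) simp
    then show ?thesis
      by (simp add: wedge_sorted_list_eq_det det_mul)
  qed
  moreover have "wedge (map D (sorted_list_of_set UNIV)) (\<lambda>h. axis (?f h) 1) = det ?J"
  proof -
    have "bij_betw ?f {..<CARD('n)} UNIV"
      using bij_betw_nth[of "sorted_list_of_set (UNIV :: 'n set)" "{..<CARD('n)}" UNIV] by simp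
    then have "?f (?g k) = k" for k
      by (simp add: bij_betw_def f_inv_into_f)
    then show ?thesis by (simp add: wedge_sorted_list_eq_det)
  qed
  ultimately show ?thesis by (metis (no_types) ext mult_zero_left)
qed

lemma congruence_symmetric:
  fixes N Z :: "real^'n^'n"
  assumes "transpose Z = Z"
  shows "transpose (transpose N ** (Z ** N)) = transpose N ** (Z ** N)"
  by (simp add: matrix_transpose_mul assms matrix_mul_assoc)

lemma symmetric_congruence_iff:
  fixes V B D :: "real^'n^'n"
  assumes "V ** B = mat 1"
  shows "transpose (transpose V ** D) = transpose V ** D \<longleftrightarrow> transpose (D ** B) = D ** B"
proof -
  have BV: "B ** V = mat 1"
    using assms by (simp add: matrix_left_right_inverse)
  have X: "transpose V ** D = transpose V ** ((D ** B) ** V)"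
    by (simp add: matrix_mul_assoc[symmetric] BV)
  have "transpose B ** transpose V = mat 1"
    using assms by (simp add: matrix_transpose_mul[symmetric])
  then have Y: "D ** B = transpose B ** ((transpose V ** D) ** B)"
    by (simp add: matrix_mul_assoc)
  show ?thesis
    using congruence_symmetric[of "transpose V ** D" B, folded Y]
      congruence_symmetric[of "D ** B" V, folded X]
    by blast
qed

lemma commutation_iff_symmetric:
  fixes V B :: "'n::{finite, linorder} sqmat" and D :: "'n \<Rightarrow> 'n \<Rightarrow> 'n \<Rightarrow> real"
  assumes "V ** B = mat 1"
  shows "(\<forall>k l m. l < m \<longrightarrow> (\<Sum>j\<in>UNIV. V $ j $ m * D j k l) = (\<Sum>i\<in>UNIV. D i k m * V $ i $ l)) \<longleftrightarrow>
    (\<forall>k c d. (\<Sum>b\<in>UNIV. D d k b * B $ b $ c) = (\<Sum>b\<in>UNIV. D c k b * B $ b $ d))"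
proof -
  let ?D = "\<lambda>k. \<chi> j l. D j k l"
  have "(\<forall>l m. l < m \<longrightarrow> (\<Sum>j\<in>UNIV. V $ j $ m * D j k l) = (\<Sum>i\<in>UNIV. D i k m * V $ i $ l)) \<longleftrightarrow>
      transpose (transpose V ** ?D k) = transpose V ** ?D k" for k
  proof -
    have "transpose (transpose V ** ?D k) = transpose V ** ?D k \<longleftrightarrow>
        (\<forall>l m. (\<Sum>j\<in>UNIV. V $ j $ m * D j k l) = (\<Sum>i\<in>UNIV. D i k m * V $ i $ l))"
      by (simp add: vec_eq_iff matrix_matrix_mult_def transpose_def mult.commute)
    moreover have "(\<Sum>j\<in>UNIV. V $ j $ m * D j k l) = (\<Sum>i\<in>UNIV. D i k m * V $ i $ l)"
      if "\<forall>l m. l < m \<longrightarrow> (\<Sum>j\<in>UNIV. V $ j $ m * D j k l) = (\<Sum>i\<in>UNIV. D i k m * V $ i $ l)" for l m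
      using that[rule_format, of l m] that[rule_format, of m l]
      by (cases l m rule: linorder_cases) (simp_all add: mult.commute)
    ultimately show ?thesis by blast
  qed
  moreover have "(\<forall>c d. (\<Sum>b\<in>UNIV. D d k b * B $ b $ c) = (\<Sum>b\<in>UNIV. D c k b * B $ b $ d)) \<longleftrightarrow>
      transpose (?D k ** B) = ?D k ** B" for k
    by (simp add: vec_eq_iff matrix_matrix_mult_def transpose_def)
  ultimately show ?thesis
    by (simp only: symmetric_congruence_iff[OF assms])
qed

lemma partial_deriv_matrix_inverse:
  fixes V B :: "real^'n \<Rightarrow> real^'k^'k"
  assumes "open S" "\<And>z. z \<in> S \<Longrightarrow> V z ** B z = mat 1" "y \<in> S"
    and V: "\<And>a b. (\<lambda>z. V z $ a $ b) differentiable at y"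
    and B: "\<And>a b. (\<lambda>z. B z $ a $ b) differentiable at y"
  shows "(\<Sum>b\<in>UNIV. V y $ a $ b * partial_deriv d (\<lambda>z. B z $ b $ c) y)
    = - (\<Sum>b\<in>UNIV. partial_deriv d (\<lambda>z. V z $ a $ b) y * B y $ b $ c)"
proof -
  have "partial_deriv d (\<lambda>z. \<Sum>b\<in>UNIV. V z $ a $ b * B z $ b $ c) y
      = partial_deriv d (\<lambda>z. (mat 1 :: real^'k^'k) $ a $ c) y"
  proof (rule partial_deriv_cong[OF assms(1,3)])
    fix z assume "z \<in> S"
    then show "(\<Sum>b\<in>UNIV. V z $ a $ b * B z $ b $ c) = (mat 1 :: real^'k^'k) $ a $ c"
      using assms(2)[of z] by (simp add: vec_eq_iff matrix_matrix_mult_def)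
  qed
  then have "(\<Sum>b\<in>UNIV. partial_deriv d (\<lambda>z. V z $ a $ b) y * B y $ b $ c
      + V y $ a $ b * partial_deriv d (\<lambda>z. B z $ b $ c) y) = 0"
    using V B by (simp add: partial_deriv_sum partial_deriv_mult differentiable_mult)
  then show ?thesis by (simp add: sum.distrib)
qed

section \<open>Changes of charts\<close>

lemma is_chart_inj_on: "is_chart (U, x) \<Longrightarrow> inj_on x U"
  by (auto simp: is_chart_def homeomorphism_def intro: inj_on_inverseI)

lemma is_chart_inv_into:
  assumes "is_chart (U, x)"
  shows "m \<in> U \<Longrightarrow> inv_into U x (x m) = m"
  using is_chart_inj_on[OF assms] by simp

lemma is_chart_open_image:
  assumes "is_chart (U, x)" "open W" "W \<subseteq> U"
  shows "open (x ` W)"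
proof -
  obtain y where U: "open (x ` U)" and h: "homeomorphism U (x ` U) x y"
    using assms(1) by (auto simp: is_chart_def)
  have "openin (top_of_set U) W"
    using assms(2,3) by (simp add: openin_open_eq[symmetric] open_subset)
  then have "openin (top_of_set (x ` U)) (x ` W)"
    by (rule homeomorphism_imp_open_map[OF h])
  then show ?thesis using U openin_open_trans by blast
qed

lemma is_chart_open_preimage:
  assumes "is_chart (U, x)" "open T" "open W" "W \<subseteq> U"
  shows "open (x -` T \<inter> W)"
proof -
  have "continuous_on U x"
    using assms(1) by (auto simp: is_chart_def homeomorphism_def)
  then have "continuous_on W x" using assms(4) continuous_on_subset by blast
  then show ?thesis using assms(2,3) by (simp add: continuous_on_open_vimage)
qed

lemma smooth_on_chart_change:
  assumes "is_chart (U, x)" "is_chart (U', x')" "smooth_transition (U, x) (U', x')"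
    and W: "open W" "W \<subseteq> U" "W \<subseteq> U'"
    and f: "smooth_on (x' ` W) (\<lambda>y. f (inv_into U' x' y))"
  shows "smooth_on (x ` W) (\<lambda>y. f (inv_into U x y))"
  unfolding smooth_on_def
proof
  fix k
  let ?g = "\<lambda>y. x' (inv_into U x y)"
  note opens = is_chart_open_image[OF assms(1) W(1,2)] is_chart_open_image[OF assms(2) W(1,3)]
  note inv = is_chart_inv_into[OF assms(1)] is_chart_inv_into[OF assms(2)]
  have g: "?g ` x ` W \<subseteq> x' ` W"
  proof
    fix z assume "z \<in> ?g ` x ` W"
    then obtain m where "m \<in> W" "z = x' (inv_into U x (x m))" by auto
    then show "z \<in> x' ` W" using inv(1) W(2) by auto
  qed
  have "Ck_on k (x ` W) (\<lambda>y. ?g y $ i)" for i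
  proof (rule Ck_on_subset)
    show "Ck_on k (x ` (U \<inter> U')) (\<lambda>y. ?g y $ i)"
      using assms(3) by (simp add: smooth_transition_def smooth_on_def)
  qed (use W in auto)
  with f have "Ck_on k (x ` W) (\<lambda>y. f (inv_into U' x' (?g y)))"
    unfolding smooth_on_def by (intro Ck_on_compose[OF opens g, of k "\<lambda>y. f (inv_into U' x' y)"]) blast+
  moreover have "f (inv_into U' x' (?g y)) = f (inv_into U x y)" if y: "y \<in> x ` W" for y
  proof -
    obtain m where m: "m \<in> W" "y = x m" using y by auto
    then have "m \<in> U" "m \<in> U'" using W by auto
    then show ?thesis using m(2) inv by simp
  qed
  ultimately show "Ck_on k (x ` W) (\<lambda>y. f (inv_into U x y))"
    by (rule Ck_on_cong[OF opens(1), rotated])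
qed

lemma smooth_fun_on_iff:
  assumes A: "smooth_atlas A" and ch: "coordinate_system A (U, x)" and W: "open W" "W \<subseteq> U"
  shows "smooth_fun_on A W f \<longleftrightarrow> smooth_on (x ` W) (\<lambda>y. f (inv_into U x y))"
proof
  have c: "is_chart (U, x)" using ch by (simp add: coordinate_system_def)
  have A': "is_chart (U', x')" "open U'" "smooth_transition (U, x) (U', x')" "smooth_transition (U', x') (U, x)"
    if "(U', x') \<in> A" for U' x'
    using A ch that by (auto simp: smooth_atlas_def coordinate_system_def compatible_def is_chart_def)
  show "smooth_on (x ` W) (\<lambda>y. f (inv_into U x y))" if f: "smooth_fun_on A W f"
    unfolding smooth_on_def
  proof (intro allI Ck_on_local is_chart_open_image[OF c W])
    fix k y assume "y \<in> x ` W"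
    then obtain m where m: "m \<in> W" "y = x m" by auto
    obtain U' x' where d: "(U', x') \<in> A" "m \<in> U'"
      using A unfolding smooth_atlas_def by (metis UNIV_I UN_E prod.collapse)
    have "smooth_on (x' ` (U' \<inter> W)) (\<lambda>y. f (inv_into U' x' y))"
      using f d by (auto simp: smooth_fun_on_def)
    then have "smooth_on (x ` (U' \<inter> W)) (\<lambda>y. f (inv_into U x y))"
      by (rule smooth_on_chart_change[OF c A'(1,3)[OF d(1)], rotated -1]) (use W A'(2)[OF d(1)] in auto)
    moreover have "open (x ` (U' \<inter> W))"
      using W A'(2)[OF d(1)] by (intro is_chart_open_image[OF c]) auto
    ultimately show "\<exists>T. open T \<and> y \<in> T \<and> Ck_on k T (\<lambda>y. f (inv_into U x y))"
      using m d(2) unfolding smooth_on_def by blast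
  qed
  show "smooth_fun_on A W f" if f: "smooth_on (x ` W) (\<lambda>y. f (inv_into U x y))"
    unfolding smooth_fun_on_def
  proof safe
    fix U' x' assume d: "(U', x') \<in> A"
    have "smooth_on (x ` (U' \<inter> W)) (\<lambda>y. f (inv_into U x y))"
      by (rule smooth_on_subset[OF f]) auto
    then show "smooth_on (x' ` (U' \<inter> W)) (\<lambda>y. f (inv_into U' x' y))"
      by (rule smooth_on_chart_change[OF A'(1)[OF d] c A'(4)[OF d], rotated -1]) (use W A'(2)[OF d] in auto)
  qed
qed

lemma coord_deriv_eq:
  "coord_deriv (U, x) j f m = partial_deriv j (\<lambda>y. f (inv_into U x y)) (x m)"
  by (simp add: coord_deriv_def differential_def partial_deriv_def)

lemma coord_deriv_inv_into:
  "is_chart (U, x) \<Longrightarrow> y \<in> x ` U \<Longrightarrow>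
    coord_deriv (U, x) j f (inv_into U x y) = partial_deriv j (\<lambda>y. f (inv_into U x y)) y"
  by (simp add: coord_deriv_eq f_inv_into_f)

lemma coord_deriv_coord_deriv_eq:
  assumes "is_chart (U, x)" "m \<in> U"
  shows "coord_deriv (U, x) c (coord_deriv (U, x) d f) m
    = partial_deriv c (partial_deriv d (\<lambda>y. f (inv_into U x y))) (x m)"
proof -
  have "open (x ` U)" using assms(1) by (simp add: is_chart_def)
  then show ?thesis
    unfolding coord_deriv_eq[of U x c]
    using assms by (intro partial_deriv_cong[of "x ` U"] coord_deriv_inv_into) auto
qed

lemma local_O2_map_iff:
  assumes A: "smooth_atlas A" and ch: "coordinate_system A (U, x)"
  shows "local_O2_map A (U, x) W u \<longleftrightarrow> open W \<and> W \<subseteq> U \<and>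
    (\<forall>b. smooth_on (x ` W) (\<lambda>y. u (inv_into U x y) $ b)) \<and> (\<forall>m\<in>W. det (jacobian (U, x) u m) \<noteq> 0)"
proof -
  have c: "is_chart (U, x)" using ch by (simp add: coordinate_system_def)
  have "jet_in_O2 (U, x) u m \<longleftrightarrow> det (jacobian (U, x) u m) \<noteq> 0"
    if "open W" "W \<subseteq> U" "m \<in> W" "\<forall>b. smooth_on (x ` W) (\<lambda>y. u (inv_into U x y) $ b)" for m
  proof -
    have "(\<lambda>y. u (inv_into U x y) $ b) differentiable at (x m)" for b
      using that by (intro smooth_on_differentiable[OF is_chart_open_image[OF c that(1,2)]]) auto
    then have "linear (differential (U, x) (\<lambda>m'. u m' $ b) m)" for b
      by (simp add: differential_def linear_frechet_derivative)
    then show ?thesis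
      unfolding jet_in_O2_def jacobian_def coord_deriv_def
      by (rule wedge_sorted_list_nonzero_iff)
  qed
  then show ?thesis
    unfolding local_O2_map_def by (auto simp: smooth_fun_on_iff[OF A ch])
qed

section \<open>Passing between the two systems\<close>

lemma commutation_equations_iff:
  assumes "invertible (V m)"
  shows "commutation_equations ch V m \<longleftrightarrow> (\<forall>a c d. Gamma_V ch V m a c d = Gamma_V ch V m a d c)"
proof -
  have "V m ** matrix_inv (V m) = mat 1"
    using assms by (simp add: invertible_det_nz matrix_inv_mult)
  from commutation_iff_symmetric[OF this, of "\<lambda>j k l. coord_deriv ch j (\<lambda>y. V y $ k $ l) m"]
  show ?thesis
    unfolding commutation_equations_def Gamma_V_def by simp
qed

lemma Gamma_u_eq_Gamma_V:
  assumes c: "is_chart (U, x)" and W: "open W" "W \<subseteq> U"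
    and u: "\<And>b. smooth_on (x ` W) (\<lambda>y. u (inv_into U x y) $ b)"
    and V: "\<And>a b. smooth_on (x ` W) (\<lambda>y. V (inv_into U x y) $ a $ b)"
    and VJ: "\<And>m. m \<in> W \<Longrightarrow> V m ** jacobian (U, x) u m = mat 1"
    and m: "m \<in> W"
  shows "Gamma_u (U, x) u m a c d = Gamma_V (U, x) V m a d c"
proof -
  let ?J = "\<lambda>z. jacobian (U, x) u (inv_into U x z)"
  let ?u = "\<lambda>b y. u (inv_into U x y) $ b"
  note S = is_chart_open_image[OF c W]
  have xm: "x m \<in> x ` W" "inv_into U x (x m) = m"
    using m W(2) is_chart_inv_into[OF c] by auto
  have J: "?J z $ b $ d = partial_deriv d (?u b) z" if "z \<in> x ` W" for z b d
    using that W(2) by (subst coord_deriv_inv_into[OF c, symmetric]) (auto simp: jacobian_def)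
  have "Ck_on (Suc 0) (x ` W) (\<lambda>z. ?J z $ b $ d)" for b d
  proof (rule Ck_on_cong[OF S J[symmetric]])
    show "Ck_on (Suc 0) (x ` W) (partial_deriv d (?u b))"
      using u[of b] unfolding smooth_on_def by (metis Ck_on.simps(2))
  qed
  note dJ = Ck_on_Suc_differentiable[OF S this xm(1)]
  have dV: "(\<lambda>y. V (inv_into U x y) $ a $ b) differentiable at (x m)" for a b
    by (rule smooth_on_differentiable[OF S V xm(1)])
  have inv: "V (inv_into U x z) ** ?J z = mat 1" if "z \<in> x ` W" for z
    using that VJ W(2) is_chart_inv_into[OF c] by auto
  have JV: "jacobian (U, x) u m ** V m = mat 1"
    using VJ[OF m] by (simp add: matrix_left_right_inverse)
  have "Gamma_u (U, x) u m a c d = (\<Sum>b\<in>UNIV. V m $ a $ b * partial_deriv c (partial_deriv d (?u b)) (x m))"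
    using m W(2) by (auto simp: Gamma_u_def matrix_inv_eqI[OF JV] coord_deriv_coord_deriv_eq[OF c])
  also have "\<dots> = (\<Sum>b\<in>UNIV. V m $ a $ b * partial_deriv c (\<lambda>z. ?J z $ b $ d) (x m))"
    by (intro sum.cong refl arg_cong2[of _ _ _ _ "(*)"] partial_deriv_cong[OF S xm(1)] J[symmetric])
  also have "\<dots> = - (\<Sum>b\<in>UNIV. partial_deriv c (\<lambda>y. V (inv_into U x y) $ a $ b) (x m) * jacobian (U, x) u m $ b $ d)"
    using partial_deriv_matrix_inverse[OF S inv xm(1) dV dJ] by (simp add: xm(2))
  also have "\<dots> = Gamma_V (U, x) V m a d c"
    by (simp add: Gamma_V_def matrix_inv_eqI[OF VJ[OF m]] coord_deriv_eq)
  finally show ?thesis .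
qed

lemma local_O2_map_imp_local_GL_map:
  assumes A: "smooth_atlas A" and ch: "coordinate_system A (U, x)" and u: "local_O2_map A (U, x) W u"
  defines "V \<equiv> \<lambda>m. matrix_inv (jacobian (U, x) u m)"
  shows "local_GL_map A (U, x) W V"
    and "m \<in> W \<Longrightarrow> commutation_equations (U, x) V m"
    and "m \<in> W \<Longrightarrow> Gamma_u (U, x) u m = Gamma_V (U, x) V m"
proof -
  have c: "is_chart (U, x)" using ch by (simp add: coordinate_system_def)
  have W: "open W" "W \<subseteq> U" and u': "\<And>b. smooth_on (x ` W) (\<lambda>y. u (inv_into U x y) $ b)"
    and det: "\<And>m. m \<in> W \<Longrightarrow> det (jacobian (U, x) u m) \<noteq> 0"
    using u by (simp_all add: local_O2_map_iff[OF A ch])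
  note S = is_chart_open_image[OF c W]
  have VJ: "V m ** jacobian (U, x) u m = mat 1" "jacobian (U, x) u m ** V m = mat 1" if "m \<in> W" for m
    using matrix_inv_mult[OF det[OF that]] by (simp_all add: V_def)
  have inv: "invertible (V m)" if "m \<in> W" for m
    using VJ[OF that] by (auto simp: invertible_def)
  have J: "Ck_on k (x ` W) (\<lambda>y. jacobian (U, x) u (inv_into U x y) $ b $ d)" for k b d
  proof (rule Ck_on_cong[OF S])
    show "Ck_on k (x ` W) (partial_deriv d (\<lambda>y. u (inv_into U x y) $ b))"
      using u'[of b] unfolding smooth_on_def by (metis Ck_on.simps(2))
    show "partial_deriv d (\<lambda>y. u (inv_into U x y) $ b) y = jacobian (U, x) u (inv_into U x y) $ b $ d"
      if "y \<in> x ` W" for y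
      using that W(2) by (subst coord_deriv_inv_into[OF c, symmetric]) (auto simp: jacobian_def)
  qed
  have "det (jacobian (U, x) u (inv_into U x y)) \<noteq> 0" if "y \<in> x ` W" for y
    using that det W(2) is_chart_inv_into[OF c] by auto
  then have V: "smooth_on (x ` W) (\<lambda>y. V (inv_into U x y) $ a $ b)" for a b
    unfolding smooth_on_def V_def by (intro allI Ck_on_matrix_inv[OF S J])
  then show "local_GL_map A (U, x) W V"
    using W inv by (simp add: local_GL_map_def smooth_fun_on_iff[OF A ch W])
  show "commutation_equations (U, x) V m" and "Gamma_u (U, x) u m = Gamma_V (U, x) V m" if m: "m \<in> W"
  proof -
    note \<Gamma> = Gamma_u_eq_Gamma_V[OF c W u' V VJ(1) m]
    have "Ck_on 2 (x ` W) (\<lambda>y. u (inv_into U x y) $ b)" for b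
      using u'[of b] by (simp add: smooth_on_def)
    then have "partial_deriv i (partial_deriv j (\<lambda>y. u (inv_into U x y) $ b)) (x m)
        = partial_deriv j (partial_deriv i (\<lambda>y. u (inv_into U x y) $ b)) (x m)" for i j b
      using m by (intro partial_deriv_commute[OF S]) auto
    then have "coord_deriv (U, x) i (coord_deriv (U, x) j (\<lambda>m'. u m' $ b)) m
        = coord_deriv (U, x) j (coord_deriv (U, x) i (\<lambda>m'. u m' $ b)) m" for i j b
      unfolding coord_deriv_coord_deriv_eq[OF c subsetD[OF W(2) m]] .
    then have u_sym: "Gamma_u (U, x) u m a i j = Gamma_u (U, x) u m a j i" for a i j
      unfolding Gamma_u_def by (intro sum.cong refl arg_cong2[of _ _ _ _ "(*)"])
    have sym: "Gamma_V (U, x) V m a i j = Gamma_V (U, x) V m a j i" for a i j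
      by (rule trans[OF trans[OF \<Gamma>[symmetric] u_sym] \<Gamma>])
    then show "commutation_equations (U, x) V m"
      by (simp only: commutation_equations_iff[of V m, OF inv[OF m]]) blast
    show "Gamma_u (U, x) u m = Gamma_V (U, x) V m"
      by (intro ext) (rule trans[OF \<Gamma> sym])
  qed
qed

lemma local_GL_map_imp_local_O2_map:
  assumes A: "smooth_atlas A" and ch: "coordinate_system A (U, x)" and V: "local_GL_map A (U, x) W V"
    and comm: "\<And>m. m \<in> W \<Longrightarrow> commutation_equations (U, x) V m" and m: "m \<in> W"
  obtains W' u where "open W'" "m \<in> W'" "W' \<subseteq> W" "local_O2_map A (U, x) W' u"
    "\<And>m'. m' \<in> W' \<Longrightarrow> V m' = matrix_inv (jacobian (U, x) u m')"
    "\<And>m'. m' \<in> W' \<Longrightarrow> Gamma_u (U, x) u m' = Gamma_V (U, x) V m'"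
proof -
  have c: "is_chart (U, x)" using ch by (simp add: coordinate_system_def)
  have W: "open W" "W \<subseteq> U" and inv: "\<And>m. m \<in> W \<Longrightarrow> det (V m) \<noteq> 0"
    using V by (auto simp: local_GL_map_def invertible_det_nz)
  have V': "smooth_on (x ` W) (\<lambda>y. V (inv_into U x y) $ a $ b)" for a b
    using V by (simp add: local_GL_map_def smooth_fun_on_iff[OF A ch W])
  note S = is_chart_open_image[OF c W]
  have invW: "inv_into U x y \<in> W" "x (inv_into U x y) = y" if "y \<in> x ` W" for y
    using that W(2) is_chart_inv_into[OF c] by auto
  have sym: "Gamma_V (U, x) V m a c d = Gamma_V (U, x) V m a d c" if "m \<in> W" for m a c d
    using comm[OF that] inv[OF that] by (simp add: commutation_equations_iff invertible_det_nz)
  define B where "B b c y = matrix_inv (V (inv_into U x y)) $ b $ c" for b c y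
  have B: "Ck_on k (x ` W) (B b c)" for k b c
    unfolding B_def using V' inv invW by (intro Ck_on_matrix_inv[OF S]) (auto simp: smooth_on_def)
  have closed: "partial_deriv d (B b c) y = partial_deriv c (B b d) y" if y: "y \<in> x ` W" for b c d y
  proof -
    let ?m = "inv_into U x y"
    let ?dB = "\<lambda>c d. \<chi> b. partial_deriv d (B b c) y"
    have "(\<Sum>b\<in>UNIV. V ?m $ a $ b * partial_deriv d (B b c) y) = Gamma_V (U, x) V ?m a c d" for a c d
    proof -
      have "V (inv_into U x z) ** matrix_inv (V (inv_into U x z)) = mat 1" if "z \<in> x ` W" for z
        using matrix_inv_mult(1) inv invW(1)[OF that] by blast
      moreover have "(\<lambda>z. V (inv_into U x z) $ a $ b) differentiable at y" for a b
        by (rule smooth_on_differentiable[OF S V' y])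
      moreover have "(\<lambda>z. matrix_inv (V (inv_into U x z)) $ a $ b) differentiable at y" for a b
        using Ck_on_Suc_differentiable[OF S B y] unfolding B_def .
      ultimately show ?thesis
        using partial_deriv_matrix_inverse[OF S _ y, of "\<lambda>z. V (inv_into U x z)" "\<lambda>z. matrix_inv (V (inv_into U x z))" a d c]
        unfolding B_def Gamma_V_def coord_deriv_eq invW(2)[OF y] by blast
    qed
    then have "V ?m *v ?dB c d = V ?m *v ?dB d c"
      using sym[OF invW(1)[OF y]] by (simp add: vec_eq_iff matrix_vector_mult_def)
    then have "matrix_inv (V ?m) *v (V ?m *v ?dB c d) = matrix_inv (V ?m) *v (V ?m *v ?dB d c)"
      by simp
    then show ?thesis
      using matrix_inv_mult(2)[OF inv[OF invW(1)[OF y]]]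
      by (simp add: matrix_vector_mul_assoc vec_eq_iff)
  qed
  obtain r where r: "0 < r" "ball (x m) r \<subseteq> x ` W"
    using S m openE by blast
  have "\<exists>v. (\<forall>y\<in>ball (x m) r. v differentiable at y) \<and>
      (\<forall>c. \<forall>y\<in>ball (x m) r. partial_deriv c v y = B b c y)" for b
  proof (rule closed_form_exact_on_ball[of "x m" r "B b"])
    show "Ck_on 1 (ball (x m) r) (B b c)" for c
      by (rule Ck_on_subset[OF B r(2)])
    show "partial_deriv d (B b c) y = partial_deriv c (B b d) y" if "y \<in> ball (x m) r" for c d y
      using closed r(2) that by blast
  qed blast
  then obtain v where v: "\<And>b y. y \<in> ball (x m) r \<Longrightarrow> v b differentiable at y"
    "\<And>b c y. y \<in> ball (x m) r \<Longrightarrow> partial_deriv c (v b) y = B b c y"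
    by metis
  define W' where "W' = x -` ball (x m) r \<inter> W"
  define u where "u m = (\<chi> b. v b (x m))" for m
  have W': "open W'" "m \<in> W'" "W' \<subseteq> W" "W' \<subseteq> U"
    using is_chart_open_preimage[OF c open_ball W] m r(1) W(2) by (auto simp: W'_def)
  note S' = is_chart_open_image[OF c W'(1,4)]
  have xW': "x ` W' \<subseteq> ball (x m) r" by (auto simp: W'_def)
  have u_eq: "v b y = u (inv_into U x y) $ b" if "y \<in> x ` W'" for b y
    using that W'(3) invW(2) by (auto simp: u_def)
  have v_smooth: "Ck_on k (ball (x m) r) (v b)" for k b
  proof (cases k)
    case 0
    then show ?thesis
      using v(1) by (auto intro!: differentiable_imp_continuous_on simp: differentiable_on_eq_differentiable_at)
  next
    case (Suc l)
    have "Ck_on l (ball (x m) r) (partial_deriv j (v b))" for j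
      by (rule Ck_on_cong[OF open_ball v(2)[symmetric] Ck_on_subset[OF B r(2)]])
    then show ?thesis
      using v(1) Suc by (simp add: differentiable_on_eq_differentiable_at)
  qed
  have u_smooth: "smooth_on (x ` W') (\<lambda>y. u (inv_into U x y) $ b)" for b
    unfolding smooth_on_def
    by (rule allI) (rule Ck_on_cong[OF S' u_eq Ck_on_subset[OF v_smooth xW']])
  have J: "jacobian (U, x) u m' = matrix_inv (V m')" if "m' \<in> W'" for m'
  proof -
    have xm': "x m' \<in> x ` W'" "x m' \<in> ball (x m) r" "inv_into U x (x m') = m'"
      using that W' xW' is_chart_inv_into[OF c] by auto
    have "jacobian (U, x) u m' $ b $ j = matrix_inv (V m') $ b $ j" for b j
    proof -
      have "jacobian (U, x) u m' $ b $ j = partial_deriv j (\<lambda>y. u (inv_into U x y) $ b) (x m')"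
        by (simp add: jacobian_def coord_deriv_eq)
      also have "\<dots> = partial_deriv j (v b) (x m')"
        by (rule partial_deriv_cong[OF S' xm'(1) u_eq[symmetric]])
      also have "\<dots> = matrix_inv (V m') $ b $ j"
        using v(2)[OF xm'(2)] by (simp add: B_def xm'(3))
      finally show ?thesis .
    qed
    then show ?thesis by (simp add: vec_eq_iff)
  qed
  have VJ: "V m' ** jacobian (U, x) u m' = mat 1" "jacobian (U, x) u m' ** V m' = mat 1" if "m' \<in> W'" for m'
    using matrix_inv_mult[OF inv] that W'(3) J[OF that] by auto
  have "det (jacobian (U, x) u m') \<noteq> 0" if "m' \<in> W'" for m'
    using VJ[OF that] by (auto simp: invertible_det_nz[symmetric] invertible_def)
  then have "local_O2_map A (U, x) W' u"
    using W' u_smooth by (simp add: local_O2_map_iff[OF A ch])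
  moreover have "V m' = matrix_inv (jacobian (U, x) u m')" if "m' \<in> W'" for m'
    using matrix_inv_eqI[OF VJ(2)[OF that]] ..
  moreover have "Gamma_u (U, x) u m' = Gamma_V (U, x) V m'" if "m' \<in> W'" for m'
  proof -
    have "smooth_on (x ` W') (\<lambda>y. V (inv_into U x y) $ a $ b)" for a b
      by (rule smooth_on_subset[OF V' image_mono[OF W'(3)]])
    then have "Gamma_u (U, x) u m' a c d = Gamma_V (U, x) V m' a d c" for a c d
      by (rule Gamma_u_eq_Gamma_V[OF c W'(1,4) u_smooth _ VJ(1) that])
    from trans[OF this sym[OF subsetD[OF W'(3) that]]] show ?thesis
      by (intro ext)
  qed
  ultimately show ?thesis
    by (rule that[OF W'(1-3)])
qed

text \<open>The equations for the components involve \<open>u\<close> and \<open>V\<close> only through \<open>\<Gamma>\<close>, so any relation \<open>R\<close> will do.\<close>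

lemma equivalent_systems_Gamma:
  fixes A :: "('m::{t2_space, second_countable_topology}, 'n::{finite, linorder}) chart set"
    and R :: "'m \<Rightarrow> ('n \<Rightarrow> 'n \<Rightarrow> 'n \<Rightarrow> real) \<Rightarrow> bool"
  assumes A: "smooth_atlas A" and ch: "coordinate_system A ch"
  shows "equivalent_systems ch
    (\<lambda>W u. local_O2_map A ch W u \<and> (\<forall>m\<in>W. R m (Gamma_u ch u m)))
    (\<lambda>W V. local_GL_map A ch W V \<and> (\<forall>m\<in>W. R m (Gamma_V ch V m)) \<and>
      (\<forall>m\<in>W. commutation_equations ch V m))"
proof -
  obtain U x where ch_eq: "ch = (U, x)" by (cases ch)
  note ch' = ch[unfolded ch_eq]
  show ?thesis
    unfolding equivalent_systems_def ch_eq
  proof (intro conjI allI impI ballI; elim conjE)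
    fix W u m
    assume u: "local_O2_map A (U, x) W u" and R: "\<forall>m\<in>W. R m (Gamma_u (U, x) u m)"
    note V = local_O2_map_imp_local_GL_map[OF A ch' u]
    show "local_GL_map A (U, x) W (\<lambda>m. matrix_inv (jacobian (U, x) u m))"
      by (rule V(1))
    show "R m (Gamma_V (U, x) (\<lambda>m. matrix_inv (jacobian (U, x) u m)) m)" if "m \<in> W"
      using R that V(3)[OF that] by metis
    show "commutation_equations (U, x) (\<lambda>m. matrix_inv (jacobian (U, x) u m)) m" if "m \<in> W"
      by (rule V(2)[OF that])
  next
    fix W V m
    assume V: "local_GL_map A (U, x) W V" and R: "\<forall>m\<in>W. R m (Gamma_V (U, x) V m)"
      and comm: "\<forall>m\<in>W. commutation_equations (U, x) V m" and m: "m \<in> W"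
    obtain W' u where "open W'" "m \<in> W'" "W' \<subseteq> W" "local_O2_map A (U, x) W' u"
      and V': "\<And>m'. m' \<in> W' \<Longrightarrow> V m' = matrix_inv (jacobian (U, x) u m')"
      and \<Gamma>: "\<And>m'. m' \<in> W' \<Longrightarrow> Gamma_u (U, x) u m' = Gamma_V (U, x) V m'"
      using local_GL_map_imp_local_O2_map[OF A ch' V _ m] comm by blast
    then show "\<exists>W' u. open W' \<and> m \<in> W' \<and> W' \<subseteq> W \<and>
        (local_O2_map A (U, x) W' u \<and> (\<forall>m\<in>W'. R m (Gamma_u (U, x) u m))) \<and>
        (\<forall>m'\<in>W'. V m' = matrix_inv (jacobian (U, x) u m'))"
      using R by (intro exI[of _ W'] exI[of _ u]) auto
  qed
qed

theorem corollary3p3: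
  fixes A :: "('m::{t2_space, second_countable_topology}, 'n::{finite, linorder}) chart set"
    and ch :: "('m, 'n) chart"
    and F Fbar :: "'n list \<Rightarrow> 'm \<Rightarrow> real"
    and p q :: nat
  assumes "smooth_atlas A"
    and "coordinate_system A ch"
    and "1 \<le> p" "p \<le> CARD('n)" "1 \<le> q" "q \<le> CARD('n)"
    and "\<And>I. I \<in> multi_indices p \<Longrightarrow> smooth_fun_on A (fst ch) (F I)"
    and "\<And>I. I \<in> multi_indices q \<Longrightarrow> smooth_fun_on A (fst ch) (Fbar I)"
  shows "equivalent_systems ch
           (solves_second_order_form A ch p F) (solves_first_order_form A ch p F) \<and>
         equivalent_systems ch
           (solves_second_order_multivector A ch q Fbar)
           (solves_first_order_multivector A ch q Fbar)"
  unfolding solves_second_order_form_def[abs_def] solves_first_order_form_def[abs_def]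
    solves_second_order_multivector_def[abs_def] solves_first_order_multivector_def[abs_def]
    Psi_def Psi_bar_def
  by (intro conjI equivalent_systems_Gamma[OF assms(1,2), where R = "\<lambda>m \<Gamma>. \<forall>J\<in>multi_indices p. \<forall>j.
        coord_deriv ch j (F J) m = Phi p \<Gamma> (\<lambda>I. F I m) j J"]
      equivalent_systems_Gamma[OF assms(1,2), where R = "\<lambda>m \<Gamma>. \<forall>J\<in>multi_indices q. \<forall>j.
        coord_deriv ch j (Fbar J) m = - Phi_bar q \<Gamma> (\<lambda>I. Fbar I m) j J"])

end
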